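(* If $n\geq k\geq 3$ are integers and $t\in[-1/(k-1),1)$, then $$\vartheta(S^{n-1},k,t)=\frac{\vartheta(S^{n-2},k-1,t/(1+t))-M_n(t)}{1-M_n(t)}.$$
   Context: $S^{n-1}=\{x\in\mathbb{R}^n:\|x\|=1\}$, $\omega$ the surface measure normalized to total measure $1$. A continuous $f\colon[-1,1]\to\mathbb{R}$ is of positive type for $S^{n-1}$ if for every finite $U\subseteq S^{n-1}$ the matrix $(f(x\cdot y))_{x,y\in U}$ is positive semidefinite. For $n\geq 2$ and $t\in[-1,1)$, $\vartheta(S^{n-1},2,t)$ is the supremum of $\int_{S^{n-1}}\int_{S^{n-1}}f(x\cdot y)\,d\omega(y)\,d\omega(x)$ over continuous $f$ of positive type for $S^{n-1}$ with $f(1)=1$, $f(t)=0$. Recursively, for $n\geq k\geq 3$ and $t\in[-1/(k-1),1)$, $\vartheta(S^{n-1},k,t)$ is the supremum of the same integral over continuous $f$ of positive type for $S^{n-1}$ with $f(1)=1$ and $f(t)\leq\vartheta(S^{n-2},k-1,t/(1+t))$. For $n\geq 2$, $j\geq 0$, $P^n_j$ denotes the Jacobi polynomial of degree $j$ with parameters $\alpha=\beta=(n-3)/2$, normalized so that $P^n_j(1)=1$. For $t\in(-1,1)$, $M_n(t)=\min\{P^n_j(t): j\geq 0\}$ (this minimum exists and is negative). *)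

theory Defs
  imports "HOL-Probability.Probability"
begin

(* The dimension changes along the recursion defining theta, so it cannot be a type: vectors of
   R^n are the functions nat => real that are extensional on {..<n}, that is, the points of the
   product space Pi_M {..<n} (%_. lborel), which carries Lebesgue measure. *)

definition vdot :: "nat \<Rightarrow> (nat \<Rightarrow> real) \<Rightarrow> (nat \<Rightarrow> real) \<Rightarrow> real" where
  "vdot n x y = (\<Sum>i<n. x i * y i)"

definition vnorm :: "nat \<Rightarrow> (nat \<Rightarrow> real) \<Rightarrow> real" where
  "vnorm n x = sqrt (\<Sum>i<n. (x i)\<^sup>2)"

abbreviation lebesgue_n :: "nat \<Rightarrow> (nat \<Rightarrow> real) measure" where
  "lebesgue_n n \<equiv> Pi\<^sub>M {..<n} (\<lambda>_. lborel)"

(* unit_sphere n is the unit sphere of R^n, usually written S^(n-1). *)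
definition unit_sphere :: "nat \<Rightarrow> (nat \<Rightarrow> real) set" where
  "unit_sphere n = {x \<in> space (lebesgue_n n). vnorm n x = 1}"

definition unit_ball :: "nat \<Rightarrow> (nat \<Rightarrow> real) set" where
  "unit_ball n = {x \<in> space (lebesgue_n n). vnorm n x \<le> 1}"

definition radial_proj :: "nat \<Rightarrow> (nat \<Rightarrow> real) \<Rightarrow> (nat \<Rightarrow> real)" where
  "radial_proj n x = (\<lambda>i\<in>{..<n}. x i / vnorm n x)"

(* Normalized surface measure: by polar coordinates, the surface area of a Borel set A of the
   sphere is n times the Lebesgue measure of the part of the ball that projects radially into A.
   The origin, whose projection is not on the sphere, is a null set. *)
definition sphere_measure :: "nat \<Rightarrow> (nat \<Rightarrow> real) measure" where
  "sphere_measure n =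
     restrict_space
       (distr (uniform_measure (lebesgue_n n) (unit_ball n)) (lebesgue_n n) (radial_proj n))
       (unit_sphere n)"

lemma space_sphere_measure: "space (sphere_measure n) = unit_sphere n"
  by (auto simp: sphere_measure_def space_restrict_space unit_sphere_def)

lemma prob_space_sphere_measure:
  assumes "n \<ge> 1"
  shows "prob_space (sphere_measure n)"
proof -
  let ?L = "lebesgue_n n"
  interpret product_sigma_finite "\<lambda>_::nat. lborel :: real measure" ..
  have norm_meas [measurable]: "vnorm n \<in> borel_measurable ?L"
    unfolding vnorm_def by measurable
  have ball [measurable]: "unit_ball n \<in> sets ?L"
    unfolding unit_ball_def by measurable
  have sphere [measurable]: "unit_sphere n \<in> sets ?L"
    unfolding unit_sphere_def by measurable
  have proj [measurable]: "radial_proj n \<in> measurable ?L ?L"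
    unfolding radial_proj_def by measurable
  have "unit_ball n = {f. sqrt (\<Sum>i\<in>{..<n}. (f i)\<^sup>2) \<le> 1} \<inter> space ?L"
    by (auto simp: unit_ball_def vnorm_def)
  then have vol: "emeasure ?L (unit_ball n) = ennreal (unit_ball_vol (real n))"
    using emeasure_cball_aux[of "{..<n}" 1] by simp
  have vol_nz: "unit_ball_vol (real n) \<noteq> 0"
    using unit_ball_vol_pos[of "real n"] by linarith
  let ?U = "uniform_measure ?L (unit_ball n)"
  let ?D = "distr ?U ?L (radial_proj n)"
  interpret U: prob_space ?U
    by (rule prob_space_uniform_measure) (simp_all add: vol vol_nz)
  interpret D: prob_space ?D
    by (rule U.prob_space_distr) simp
  define Z where "Z = (\<Pi>\<^sub>E i\<in>{..<n}. {0::real})"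
  have Z: "Z \<in> sets ?L"
    unfolding Z_def by (intro sets_PiM_I_finite) auto
  have "emeasure ?L Z = (\<Prod>i<n. emeasure lborel {0::real})"
    unfolding Z_def by (rule emeasure_PiM) auto
  also have "\<dots> = 0"
    using assms by auto
  finally have null: "Z \<in> null_sets ?L"
    using Z by auto
  have "AE x in ?L. x \<notin> Z"
    using null by (rule AE_not_in)
  then have nz: "AE x in ?U. x \<notin> Z"
    using Z by (intro AE_uniform_measureI) auto
  have on_sphere: "radial_proj n x \<in> unit_sphere n" if x: "x \<in> space ?L" "x \<notin> Z" for x
  proof -
    have "\<exists>i<n. x i \<noteq> 0"
      using x unfolding Z_def space_PiM PiE_iff by auto
    then have pos: "(\<Sum>i<n. (x i)\<^sup>2) > 0"
      by (auto intro: sum_pos2)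
    have "(\<Sum>i<n. (radial_proj n x i)\<^sup>2) = (\<Sum>i<n. (x i)\<^sup>2) / (vnorm n x)\<^sup>2"
      by (simp add: radial_proj_def power_divide sum_divide_distrib)
    also have "\<dots> = 1"
      using pos by (simp add: vnorm_def sum_nonneg)
    finally show ?thesis
      by (simp add: unit_sphere_def vnorm_def space_PiM radial_proj_def)
  qed
  have "AE x in ?U. radial_proj n x \<in> unit_sphere n"
    by (rule AE_mp[OF nz]) (rule AE_I2, simp add: on_sphere)
  then have "AE x in ?D. x \<in> unit_sphere n"
    by (subst AE_distr_iff) auto
  then have "emeasure ?D (unit_sphere n) = 1"
    by (intro D.emeasure_eq_1_AE) auto
  then show ?thesis
    unfolding sphere_measure_def by (intro prob_spaceI) (simp add: emeasure_restrict_space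
        space_restrict_space unit_sphere_def Int_absorb2 Int_absorb1)
qed

definition psd_on :: "'a set \<Rightarrow> ('a \<Rightarrow> 'a \<Rightarrow> real) \<Rightarrow> bool" where
  "psd_on U A \<longleftrightarrow>
     (\<forall>x\<in>U. \<forall>y\<in>U. A x y = A y x) \<and>
     (\<forall>c :: 'a \<Rightarrow> real. (\<Sum>x\<in>U. \<Sum>y\<in>U. A x y * c x * c y) \<ge> 0)"

(* A function on [-1,1] is a total function on the reals whose values outside [-1,1] are never
   looked at. *)
definition positive_type :: "nat \<Rightarrow> (real \<Rightarrow> real) \<Rightarrow> bool" where
  "positive_type n f \<longleftrightarrow>
     (\<forall>U. finite U \<longrightarrow> U \<subseteq> unit_sphere n \<longrightarrow> psd_on U (\<lambda>x y. f (vdot n x y)))"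

definition sphere_integral :: "nat \<Rightarrow> (real \<Rightarrow> real) \<Rightarrow> real" where
  "sphere_integral n f =
     (\<integral>x. (\<integral>y. f (vdot n x y) \<partial>sphere_measure n) \<partial>sphere_measure n)"

(* theta n k t is the number written vartheta(S^(n-1), k, t). It is meaningful for
   n >= k = 2, -1 <= t < 1 and for n >= k >= 3, -1/(k-1) <= t < 1; there the set is nonempty
   and bounded above by 1. *)
fun theta :: "nat \<Rightarrow> nat \<Rightarrow> real \<Rightarrow> real" where
  "theta n k t =
     (if k < 2 then undefined
      else if k = 2 then
        Sup {sphere_integral n f | f.
               continuous_on {-1..1} f \<and> positive_type n f \<and> f 1 = 1 \<and> f t = 0}
      else
        Sup {sphere_integral n f | f.
               continuous_on {-1..1} f \<and> positive_type n f \<and> f 1 = 1 \<and>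
               f t \<le> theta (n - 1) (k - 1) (t / (1 + t))})"

declare theta.simps [simp del]

(* The explicit formula for the classical Jacobi polynomials (Szego, Orthogonal Polynomials,
   (4.3.2)); unlike the formulas with Gamma quotients it needs no exception at
   alpha + beta = -1. *)
definition jacobi :: "real \<Rightarrow> real \<Rightarrow> nat \<Rightarrow> real \<Rightarrow> real" where
  "jacobi \<alpha> \<beta> j x =
     (\<Sum>s\<le>j. ((real j + \<alpha>) gchoose (j - s)) * ((real j + \<beta>) gchoose s) *
        ((x - 1) / 2) ^ s * ((x + 1) / 2) ^ (j - s))"

definition jacobi_sphere :: "nat \<Rightarrow> nat \<Rightarrow> real \<Rightarrow> real" where
  "jacobi_sphere n j x =
     (let \<alpha> = (real n - 3) / 2 in jacobi \<alpha> \<alpha> j x / jacobi \<alpha> \<alpha> j 1)"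

lemma jacobi_sphere_at_1:
  assumes "n \<ge> 2"
  shows "jacobi_sphere n j 1 = 1"
proof -
  define a where "a = (real n - 3) / 2"
  have a: "a > -1"
    using assms by (simp add: a_def)
  have "jacobi a a j 1 =
      (\<Sum>s\<in>{0}. ((real j + a) gchoose (j - s)) * ((real j + a) gchoose s) *
        ((1 - 1) / 2) ^ s * ((1 + 1) / 2) ^ (j - s))"
    unfolding jacobi_def by (intro sum.mono_neutral_right) auto
  then have "jacobi a a j 1 = (real j + a) gchoose j"
    by simp
  also have "\<dots> = (\<Prod>i<j. real j + a - real i) / fact j"
    by (simp add: gbinomial_prod_rev lessThan_atLeast0)
  also have "\<dots> > 0"
  proof (intro divide_pos_pos prod_pos)
    fix i assume "i \<in> {..<j}"
    then have "real i + 1 \<le> real j"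
      by simp
    then show "real j + a - real i > 0"
      using a by linarith
  qed simp
  finally show ?thesis
    by (simp add: jacobi_sphere_def Let_def a_def)
qed

(* The set is infinite, so Min does not apply; LEAST denotes its least element. *)
definition jacobi_min :: "nat \<Rightarrow> real \<Rightarrow> real" where
  "jacobi_min n t = (LEAST v. v \<in> range (\<lambda>j. jacobi_sphere n j t))"

end

theory Submission
  imports Defs
begin

text \<open>Let \<open>P\<^sub>j\<close> be the normalized Jacobi polynomials and write a function \<open>f\<close> of positive type
  with \<open>f 1 = 1\<close> as \<open>\<Sum>j. a\<^sub>j P\<^sub>j\<close> with \<open>a\<^sub>j \<ge> 0\<close> and \<open>\<Sum>j. a\<^sub>j = 1\<close>, as in Schoenberg's theorem. Then the
  double integral of \<open>f\<close> is \<open>a\<^sub>0\<close>, and \<open>f t \<ge> a\<^sub>0 + (1 - a\<^sub>0) M\<close>, where \<open>M\<close> is the least value \<open>P\<^sub>j t\<close>. The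
  bound \<open>f t \<le> c\<close> therefore gives \<open>a\<^sub>0 \<le> (c - M) / (1 - M)\<close>, and equality holds for a suitable mixture
  of \<open>P\<^sub>0\<close> and the minimizing \<open>P\<^sub>j\<close>.

  Convergence of the expansion is avoided by convolving \<open>f\<close> with polynomials peaked at \<open>1\<close> that are
  nonnegative combinations of the \<open>P\<^sub>j\<close>. Everything about \<open>P\<^sub>j\<close> is drawn from the three-term
  recurrence, and everything about the sphere from the fact that \<open>\<integral> (v \<bullet> z)\<^sup>m\<close> depends only on the
  norm of \<open>v\<close>, which is read off from the Gaussian measure.\<close>

section \<open>Ultraspherical polynomials\<close>

text \<open>The minimum over infinitely many \<open>P\<^sub>j t\<close> is attained because
  \<open>P\<^sub>j t\<close> tends to 0 while at least one value is negative. The decay requires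
  \<open>n \<ge> 3\<close>: for n = 2 these are the Chebyshev polynomials, with values cos (j arccos
  t), which do not decay. It also requires t > -1, which the range of t gives for
  \<open>k \<ge> 3\<close>.

  The extremal mixture has positive type only if its weight (c - M) / (1 - M) lies in [0,1], which
  follows once c does. Hence the recursion carries the invariant
  \<open>theta n k t \<in> {0..1}\<close>; it is established at k = 2 and preserved by the formula
  itself.

  Orthogonality is treated as algebra. The classical weight (1 - x^2) ^ ((n - 3) / 2) enters only
  through a recursion for its moments, which the sphere supplies by inserting sum z_i^2 = 1 under
  the integral. Positivity of the norms follows from the signs in the three-term recurrence.
  Rotations of the sphere never appear: the moment formula for one linear form, polarized to two
  forms, takes the place of invariance under them.\<close>

definition jac_weight :: "real \<Rightarrow> nat \<Rightarrow> real" where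
  "jac_weight \<alpha> s = fact s * pochhammer (\<alpha> + 1) s"

lemma jac_weight_pos: "\<alpha> > -1 \<Longrightarrow> jac_weight \<alpha> s > 0"
  unfolding jac_weight_def by (intro mult_pos_pos pochhammer_pos) auto

lemma jac_weight_0 [simp]: "jac_weight \<alpha> 0 = 1"
  by (simp add: jac_weight_def)

lemma jac_weight_Suc: "jac_weight \<alpha> (Suc s) = (real s + 1) * (real s + 1 + \<alpha>) * jac_weight \<alpha> s"
  by (simp add: jac_weight_def pochhammer_Suc algebra_simps)

text \<open>The falling product from j + \<alpha> down to j + \<alpha> - s + 1 is the upper end of
  \<open>pochhammer (\<alpha> + 1) j\<close>; the lower end, positive since \<alpha> > -1, is
  divided out.\<close>

lemma gchoose_shift:
  fixes \<alpha> :: real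
  assumes "\<alpha> > -1" "s \<le> j"
  shows "(real j + \<alpha>) gchoose s = pochhammer (\<alpha> + 1) j / (pochhammer (\<alpha> + 1) (j - s) * fact s)"
proof -
  have "pochhammer (\<alpha> + 1) j
      = pochhammer (\<alpha> + 1) (j - s) * pochhammer (\<alpha> + 1 + real (j - s)) s"
    using pochhammer_product[of "j - s" j "\<alpha> + 1"] assms(2) by simp
  moreover have "pochhammer (\<alpha> + 1) (j - s) > 0"
    using assms by (intro pochhammer_pos) auto
  moreover have "\<alpha> + 1 + real (j - s) = real j + \<alpha> - real s + 1"
    using assms(2) by (simp add: of_nat_diff)
  ultimately show ?thesis
    by (simp add: gbinomial_pochhammer' field_simps)
qed

lemma jacobi_eq_weights:
  assumes "\<alpha> > -1"
  shows "jacobi \<alpha> \<alpha> j x = (pochhammer (\<alpha> + 1) j)\<^sup>2 *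
    (\<Sum>s\<le>j. ((x - 1) / 2) ^ s * ((x + 1) / 2) ^ (j - s) / (jac_weight \<alpha> s * jac_weight \<alpha> (j - s)))"
  unfolding jacobi_def sum_distrib_left
proof (rule sum.cong, goal_cases)
  case (2 s)
  then have s: "s \<le> j" by simp
  have "(real j + \<alpha>) gchoose (j - s) = pochhammer (\<alpha> + 1) j / (pochhammer (\<alpha> + 1) s * fact (j - s))"
    using gchoose_shift[OF assms, of "j - s" j] s by simp
  then show ?case
    using gchoose_shift[OF assms s] by (simp add: jac_weight_def power2_eq_square field_simps)
qed simp

text \<open>This is the coefficient of z^j in F(a z) F(b z), where F(z) is the sum of z^s /
  \<open>jac_weight \<alpha> s\<close>, a hypergeometric 0F1: Bateman's generating function for the
  Jacobi polynomials.\<close>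

definition jac_sum :: "real \<Rightarrow> real \<Rightarrow> real \<Rightarrow> nat \<Rightarrow> real" where
  "jac_sum \<alpha> a b j = (\<Sum>s\<le>j. a ^ s * b ^ (j - s) / (jac_weight \<alpha> s * jac_weight \<alpha> (j - s)))"

text \<open>At x = 1 only the term s = 0 survives, so the normalization cancels the squared
  Pochhammer factor and leaves one weight.\<close>

lemma jacobi_sphere_eq_jac_sum:
  assumes "n \<ge> 2"
  defines "\<alpha> \<equiv> (real n - 3) / 2"
  shows "jacobi_sphere n j x = jac_weight \<alpha> j * jac_sum \<alpha> ((x - 1) / 2) ((x + 1) / 2) j"
proof -
  have \<alpha>: "\<alpha> > -1" using assms by (simp add: \<alpha>_def)
  have "(\<Sum>s\<le>j. 0 ^ s * 1 ^ (j - s) / (jac_weight \<alpha> s * jac_weight \<alpha> (j - s)))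
      = (\<Sum>s\<in>{0}. 0 ^ s * 1 ^ (j - s) / (jac_weight \<alpha> s * jac_weight \<alpha> (j - s)))"
    by (intro sum.mono_neutral_right) auto
  then have "jacobi \<alpha> \<alpha> j 1 = (pochhammer (\<alpha> + 1) j)\<^sup>2 / jac_weight \<alpha> j"
    using jacobi_eq_weights[OF \<alpha>, of j 1] by simp
  moreover have "pochhammer (\<alpha> + 1) j > 0"
    using \<alpha> by (intro pochhammer_pos) auto
  ultimately show ?thesis
    using jacobi_eq_weights[OF \<alpha>, of j x]
    by (simp add: jacobi_sphere_def Let_def \<alpha>_def[symmetric] jac_sum_def)
qed

text \<open>An extra weight in both exponents turns multiplication by \<open>a\<close> or
  \<open>b\<close> into a change of weight, so that identities between sums become polynomial
  identities in s and q.\<close>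

definition jac_wsum :: "real \<Rightarrow> real \<Rightarrow> real \<Rightarrow> (nat \<Rightarrow> nat \<Rightarrow> real) \<Rightarrow> nat \<Rightarrow> real" where
  "jac_wsum \<alpha> a b w j =
    (\<Sum>s\<le>j. w s (j - s) * (a ^ s * b ^ (j - s) / (jac_weight \<alpha> s * jac_weight \<alpha> (j - s))))"

lemma jac_wsum_swap: "jac_wsum \<alpha> a b w j = jac_wsum \<alpha> b a (\<lambda>s q. w q s) j"
  unfolding jac_wsum_def
  by (rule sum.reindex_bij_witness[of _ "\<lambda>s. j - s" "\<lambda>s. j - s"]) (auto simp: mult_ac)

text \<open>An index shift. The new term s = 0 has weight 0, so the truncated \<open>s - 1\<close>
  does no harm there.\<close>

lemma jac_wsum_times_a:
  assumes "\<alpha> > -1"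
  shows "a * jac_wsum \<alpha> a b w j
    = jac_wsum \<alpha> a b (\<lambda>s q. real s * (real s + \<alpha>) * w (s - 1) q) (Suc j)"
proof -
  have "real (Suc s) * (real (Suc s) + \<alpha>) * w s q
      * (a ^ Suc s * b ^ q / (jac_weight \<alpha> (Suc s) * jac_weight \<alpha> q))
    = a * (w s q * (a ^ s * b ^ q / (jac_weight \<alpha> s * jac_weight \<alpha> q)))" for s q
  proof -
    define c where "c = (real s + 1) * (real s + 1 + \<alpha>)"
    have "c \<noteq> 0" using assms by (simp add: c_def)
    moreover have "real (Suc s) * (real (Suc s) + \<alpha>) = c"
      by (simp add: c_def algebra_simps)
    moreover have "jac_weight \<alpha> (Suc s) = c * jac_weight \<alpha> s"
      by (simp add: c_def jac_weight_Suc)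
    ultimately show ?thesis by (simp add: mult_ac)
  qed
  then show ?thesis
    unfolding jac_wsum_def sum.atMost_Suc_shift sum_distrib_left
    by (simp cong: sum.cong)
qed

lemma jac_wsum_times_b:
  assumes "\<alpha> > -1"
  shows "b * jac_wsum \<alpha> a b w j
    = jac_wsum \<alpha> a b (\<lambda>s q. real q * (real q + \<alpha>) * w s (q - 1)) (Suc j)"
  by (subst (1 2) jac_wsum_swap) (rule jac_wsum_times_a[OF assms])

lemma jac_sum_eq_wsum: "jac_sum \<alpha> a b j = jac_wsum \<alpha> a b (\<lambda>_ _. 1) j"
  by (simp add: jac_sum_def jac_wsum_def)

lemma jac_wsum_cmult: "c * jac_wsum \<alpha> a b w j = jac_wsum \<alpha> a b (\<lambda>s q. c * w s q) j"
  by (simp add: jac_wsum_def sum_distrib_left mult_ac)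

lemma jac_wsum_add: "jac_wsum \<alpha> a b w j + jac_wsum \<alpha> a b w' j = jac_wsum \<alpha> a b (\<lambda>s q. w s q + w' s q) j"
  by (simp add: jac_wsum_def sum.distrib[symmetric] ring_distribs add_divide_distrib)

lemma jac_wsum_cong:
  "(\<And>s q. s + q = j \<Longrightarrow> w s q = w' s q) \<Longrightarrow> jac_wsum \<alpha> a b w j = jac_wsum \<alpha> a b w' j"
  unfolding jac_wsum_def by (intro sum.cong) auto

text \<open>The homogeneous three-term recurrence: a = (x - 1) / 2 and b = (x + 1) / 2 give a + b =
  x and b - a = 1. With every term raised to degree j + 2, it suffices to compare the weights where
  s + q = j + 2.\<close>

lemma jac_sum_recurrence:
  assumes "\<alpha> > -1"
  shows "(real j + 2 + 2 * \<alpha>) * (real j + 2) * (real j + 2 + \<alpha>) * (real j + 1 + \<alpha>) * jac_sum \<alpha> a b (Suc (Suc j))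
    = (2 * real j + 3 + 2 * \<alpha>) * (real j + 1 + \<alpha>) * (a + b) * jac_sum \<alpha> a b (Suc j)
      - (b - a)\<^sup>2 * jac_sum \<alpha> a b j"
proof -
  let ?S = "jac_wsum \<alpha> a b"
  define u where "u = (\<lambda>s. real s * (real s + \<alpha>))"
  have "(b - a)\<^sup>2 * jac_sum \<alpha> a b j
      = a * (a * ?S (\<lambda>_ _. 1) j) + (-2) * (a * (b * ?S (\<lambda>_ _. 1) j)) + b * (b * ?S (\<lambda>_ _. 1) j)"
    by (simp add: jac_sum_eq_wsum power2_eq_square algebra_simps)
  also have "\<dots> = ?S (\<lambda>s q. u s * u (s - 1) + (-2) * (u s * u q) + u q * u (q - 1)) (Suc (Suc j))"
    unfolding jac_wsum_times_a[OF assms] jac_wsum_times_b[OF assms]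
    unfolding jac_wsum_cmult jac_wsum_add
    by (simp add: u_def)
  finally have 1: "(b - a)\<^sup>2 * jac_sum \<alpha> a b j = \<dots>" .
  have "(a + b) * jac_sum \<alpha> a b (Suc j) = a * ?S (\<lambda>_ _. 1) (Suc j) + b * ?S (\<lambda>_ _. 1) (Suc j)"
    by (simp add: jac_sum_eq_wsum algebra_simps)
  also have "\<dots> = ?S (\<lambda>s q. u s + u q) (Suc (Suc j))"
    unfolding jac_wsum_times_a[OF assms] jac_wsum_times_b[OF assms]
    unfolding jac_wsum_cmult jac_wsum_add
    by (simp add: u_def)
  finally have 2: "(a + b) * jac_sum \<alpha> a b (Suc j) = \<dots>" .
  \<comment> \<open>Replaces the natural subtraction by a real one; at s = 0 both sides vanish
    because of the factor s.\<close>
  have u': "u s * u (s - 1) = real s * (real s + \<alpha>) * ((real s - 1) * (real s - 1 + \<alpha>))" for s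
    by (cases s) (auto simp: u_def)
  have "(real j + 2 + 2 * \<alpha>) * (real j + 2) * (real j + 2 + \<alpha>) * (real j + 1 + \<alpha>) * jac_sum \<alpha> a b (Suc (Suc j))
     + (b - a)\<^sup>2 * jac_sum \<alpha> a b j
    = ((2 * real j + 3 + 2 * \<alpha>) * (real j + 1 + \<alpha>)) * ((a + b) * jac_sum \<alpha> a b (Suc j))"
    unfolding 1 2 unfolding jac_sum_eq_wsum unfolding jac_wsum_cmult jac_wsum_add
  proof (rule jac_wsum_cong, goal_cases)
    case (1 s q)
    then have "real j = real s + real q - 2" by linarith
    then show ?case
      unfolding u' unfolding u_def by algebra
  qed
  then show ?thesis by (simp add: algebra_simps)
qed

text \<open>Gegenbauer polynomials normalized to 1 at 1, with d = 2 \<alpha> + 1 = n - 2: Chebyshev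
  for d = 0, Legendre for d = 1.\<close>

fun ultra :: "real \<Rightarrow> nat \<Rightarrow> real poly" where
  "ultra d 0 = 1"
| "ultra d (Suc 0) = [:0, 1:]"
| "ultra d (Suc (Suc j)) = smult (1 / (real j + 1 + d))
     (smult (2 * real j + 2 + d) ([:0, 1:] * ultra d (Suc j)) - smult (real j + 1) (ultra d j))"

lemma jacobi_sphere_eq_ultra:
  assumes "n \<ge> 2"
  shows "jacobi_sphere n j x = poly (ultra (real n - 2) j) x"
proof -
  define \<alpha> where "\<alpha> = (real n - 3) / 2"
  have \<alpha>: "\<alpha> \<ge> -1/2" using assms by (simp add: \<alpha>_def)
  have d: "real n - 2 = 2 * \<alpha> + 1" by (simp add: \<alpha>_def field_simps)
  have "jac_weight \<alpha> j * jac_sum \<alpha> ((x - 1) / 2) ((x + 1) / 2) j = poly (ultra (real n - 2) j) x"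
    unfolding d
  proof (induction "2 * \<alpha> + 1" j rule: ultra.induct)
    case 1
    show ?case by (simp add: jac_sum_def)
  next
    case 2
    have "jac_weight \<alpha> (Suc 0) \<noteq> 0"
      using jac_weight_pos[of \<alpha> "Suc 0"] \<alpha> by auto
    then show ?case by (simp add: jac_sum_def add_divide_distrib[symmetric])
  next
    case (3 j)
    let ?a = "(x - 1) / 2" and ?b = "(x + 1) / 2"
    have ab: "?a + ?b = x" "?b - ?a = 1" by (auto simp: field_simps)
    let ?w = "jac_weight \<alpha> j" and ?S = "jac_sum \<alpha> ?a ?b"
    have "(real j + 2 + 2 * \<alpha>) * (jac_weight \<alpha> (Suc (Suc j)) * ?S (Suc (Suc j))) =
      (real j + 1) * ?w * ((real j + 2 + 2 * \<alpha>) * (real j + 2) * (real j + 2 + \<alpha>) * (real j + 1 + \<alpha>) * ?S (Suc (Suc j)))"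
      by (simp add: jac_weight_Suc algebra_simps)
    also have "\<dots> = (2 * real j + 3 + 2 * \<alpha>) * x * (jac_weight \<alpha> (Suc j) * ?S (Suc j)) - (real j + 1) * (?w * ?S j)"
      using \<alpha> unfolding jac_sum_recurrence[OF order.strict_trans2[OF _ \<alpha>, of "-1", simplified]] ab
      by (simp add: jac_weight_Suc algebra_simps)
    finally show ?case
      using \<alpha> 3 by (simp add: field_simps)
  qed
  then show ?thesis
    using jacobi_sphere_eq_jac_sum[OF assms] by (simp add: \<alpha>_def)
qed

lemma poly_ultra_Suc_Suc:
  assumes "d \<ge> 0"
  shows "(real j + 1 + d) * poly (ultra d (Suc (Suc j))) x
    = (2 * real j + 2 + d) * x * poly (ultra d (Suc j)) x - (real j + 1) * poly (ultra d j) x"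
proof -
  have "real j + 1 + d \<noteq> 0" using assms by linarith
  then show ?thesis by (simp add: right_diff_distrib)
qed

text \<open>The recurrence read as a multiplication rule. That both coefficients are nonnegative
  drives \<open>monom_in_cone\<close> and \<open>\<nu>_pos\<close>.\<close>

lemma x_times_ultra:
  assumes "d \<ge> 0"
  shows "[:0, 1:] * ultra d (Suc j) =
    smult ((real j + 1 + d) / (2 * real j + 2 + d)) (ultra d (Suc (Suc j)))
    + smult ((real j + 1) / (2 * real j + 2 + d)) (ultra d j)"
proof (rule poly_eq_poly_eq_iff[THEN iffD1], rule ext)
  fix x
  show "poly ([:0, 1:] * ultra d (Suc j)) x = poly (smult ((real j + 1 + d) / (2 * real j + 2 + d)) (ultra d (Suc (Suc j)))
    + smult ((real j + 1) / (2 * real j + 2 + d)) (ultra d j)) x"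
  proof -
    have nz: "2 * real j + 2 + d \<noteq> 0" using assms by linarith
    have "x * poly (ultra d (Suc j)) x
      = ((real j + 1 + d) * poly (ultra d (Suc (Suc j))) x + (real j + 1) * poly (ultra d j) x)
        / (2 * real j + 2 + d)"
      unfolding poly_ultra_Suc_Suc[OF assms, of j x] using nz by simp
    also have "\<dots> = (real j + 1 + d) / (2 * real j + 2 + d) * poly (ultra d (Suc (Suc j))) x
        + (real j + 1) / (2 * real j + 2 + d) * poly (ultra d j) x"
    proof -
      have "(A * y + B * z) / D = A / D * y + B / D * z" for A B D y z :: real
        by (simp add: add_divide_distrib)
      then show ?thesis .
    qed
    finally show ?thesis by (simp del: ultra.simps)
  qed
qed

lemma degree_ultra: "degree (ultra d j) \<le> j"
proof (induction d j rule: ultra.induct)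
  case (3 d j)
  have "degree ([:0, 1:] * ultra d (Suc j)) \<le> Suc (Suc j)"
    using degree_mult_le[of "[:0, 1:]" "ultra d (Suc j)"] 3 by simp
  then show ?case
    using 3 by (auto intro!: degree_diff_le degree_smult_le[THEN order_trans])
qed auto

lemma poly_ultra_1: "d \<ge> 0 \<Longrightarrow> poly (ultra d j) 1 = 1"
proof (induction d j rule: ultra.induct)
  case (3 d j)
  then have "(real j + 1 + d) * poly (ultra d (Suc (Suc j))) 1 = real j + 1 + d"
    using poly_ultra_Suc_Suc[of d j 1] by simp
  with 3 show ?case by (auto simp del: ultra.simps)
qed auto

text \<open>Differentiating the recurrence expresses the derivative at index i + 2 through those at
  i + 1 and i; the former is the induction hypothesis, the latter is \<open>prev\<close>.\<close>

lemma pderiv_ultra: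
  assumes "d \<ge> 0"
  shows "(1 - x\<^sup>2) * poly (pderiv (ultra d (Suc j))) x
    = (real j + 1) * (poly (ultra d j) x - x * poly (ultra d (Suc j)) x)"
proof (induction j rule: less_induct)
  case (less j)
  let ?P = "\<lambda>j. poly (ultra d j) x" and ?D = "\<lambda>j. poly (pderiv (ultra d j)) x"
  show ?case
  proof (cases j)
    case 0
    then show ?thesis by (simp add: pderiv_pCons power2_eq_square)
  next
    case (Suc i)
    have rec: "(real i + 1 + d) * ?P (Suc (Suc i)) = (2 * real i + 2 + d) * x * ?P (Suc i) - (real i + 1) * ?P i"
      using poly_ultra_Suc_Suc[OF assms] .
    \<comment> \<open>The companion relation, which uses the next polynomial instead of the previous
      one: the recurrence eliminates the lowest index from the induction hypothesis.\<close>
    have prev: "(1 - x\<^sup>2) * ?D i = (real i + d) * (x * ?P i - ?P (Suc i))"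
    proof (cases i)
      case (Suc k)
      have "(real k + 1 + d) * ?P (Suc (Suc k)) = (2 * real k + 2 + d) * x * ?P (Suc k) - (real k + 1) * ?P k"
        using poly_ultra_Suc_Suc[OF assms] .
      moreover have "(1 - x\<^sup>2) * ?D (Suc k) = (real k + 1) * (?P k - x * ?P (Suc k))"
        using less[of k] Suc \<open>j = Suc i\<close> by simp
      ultimately show ?thesis
        unfolding Suc by (simp del: ultra.simps add: algebra_simps)
    qed simp
    have cur: "(1 - x\<^sup>2) * ?D (Suc i) = (real i + 1) * (?P i - x * ?P (Suc i))"
      using less[of i] Suc by simp
    have nz: "real i + 1 + d \<noteq> 0" using assms by linarith
    have drec: "(real i + 1 + d) * ?D (Suc (Suc i))
        = (2 * real i + 2 + d) * (?P (Suc i) + x * ?D (Suc i)) - (real i + 1) * ?D i"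
    proof -
      have "smult (real i + 1 + d) (ultra d (Suc (Suc i)))
        = smult (2 * real i + 2 + d) ([:0, 1:] * ultra d (Suc i)) - smult (real i + 1) (ultra d i)"
        using nz by simp
      from arg_cong[OF this, of "\<lambda>p. poly (pderiv p) x"] show ?thesis
        by (simp del: ultra.simps add: pderiv_smult pderiv_diff pderiv_pCons algebra_simps)
    qed
    have "(real i + 1 + d) * ((1 - x\<^sup>2) * ?D (Suc (Suc i)))
      = (real i + 1 + d) * ((real i + 2) * (?P (Suc i) - x * ?P (Suc (Suc i))))"
      using cur prev rec drec by algebra
    with nz show ?thesis using Suc by (simp del: ultra.simps)
  qed
qed

text \<open>The recurrence is a perturbation by a damping term of order \<open>d / j\<close> of the rotation
  \<open>p (j + 2) = 2 t p (j + 1) - p j\<close>, whose invariant quadratic form is \<open>V\<close> below. Since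
  \<open>\<Sum> d / j\<close> diverges, the damping forces \<open>V\<close> to \<open>0\<close>.\<close>

lemma damped_recurrence_tendsto_0:
  fixes p :: "nat \<Rightarrow> real"
  assumes d: "d > 0" and t: "\<bar>t\<bar> < 1"
    and rec: "\<And>j. (real j + 1 + d) * p (Suc (Suc j)) = (2 * real j + 2 + d) * t * p (Suc j) - (real j + 1) * p j"
  shows "p \<longlonglongrightarrow> 0"
proof -
  \<comment> \<open>With these, p (j + 2) = t p (j + 1) + (1 - \<delta> j) e j; \<delta> = 0 would
    be the pure rotation.\<close>
  define \<delta> where "\<delta> j = d / (real j + 1 + d)" for j
  define e where "e j = t * p (Suc j) - p j" for j
  define V where "V j = (e j)\<^sup>2 + (1 - t\<^sup>2) * (p (Suc j))\<^sup>2" for j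
  have t2: "1 - t\<^sup>2 > 0" using t by (simp add: abs_square_less_1)
  have \<delta>: "0 < \<delta> j" "\<delta> j \<le> 1" "\<delta> (Suc j) \<le> \<delta> j" for j
    using d by (auto simp: \<delta>_def field_simps)
  have step: "p (Suc (Suc j)) = t * p (Suc j) + (1 - \<delta> j) * e j" for j
  proof -
    have "real j + 1 + d \<noteq> 0" using d by linarith
    then show ?thesis using rec[of j] by (simp add: \<delta>_def e_def field_simps)
  qed
  have V_step: "V (Suc j) = V j - (2 * \<delta> j - (\<delta> j)\<^sup>2) * (e j)\<^sup>2" for j
    unfolding V_def e_def[of "Suc j"] step by (simp add: power2_eq_square algebra_simps)
  have V_dec: "V (Suc j) \<le> V j - \<delta> j * (e j)\<^sup>2" for j
  proof -
    have "\<delta> j * \<delta> j \<le> \<delta> j * 1" using \<delta>[of j] by (intro mult_left_mono) auto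
    then have "\<delta> j \<le> 2 * \<delta> j - (\<delta> j)\<^sup>2" by (simp add: power2_eq_square)
    then have "\<delta> j * (e j)\<^sup>2 \<le> (2 * \<delta> j - (\<delta> j)\<^sup>2) * (e j)\<^sup>2"
      by (intro mult_right_mono) auto
    then show ?thesis using V_step by simp
  qed
  have V0: "V j \<ge> 0" for j using t2 by (simp add: V_def)
  have "decseq V"
  proof (rule decseq_SucI)
    fix j
    have "0 \<le> \<delta> j * (e j)\<^sup>2" using \<delta>[of j] by simp
    then show "V (Suc j) \<le> V j" using V_dec[of j] by linarith
  qed
  then obtain c where c: "V \<longlonglongrightarrow> c" "\<And>j. c \<le> V j"
    using decseq_convergent[of V 0] V0 by metis
  have "(\<Sum>j<N. \<delta> j * (e j)\<^sup>2) \<le> V 0 - V N" for N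
  proof (induction N)
    case (Suc N)
    then show ?case using V_dec[of N] by simp
  qed simp
  then have "(\<Sum>j<N. \<delta> j * (e j)\<^sup>2) \<le> V 0" for N
    by (rule order_trans) (use V0[of N] in simp)
  then have summ: "summable (\<lambda>j. \<delta> j * (e j)\<^sup>2)"
    using \<delta>(1) by (intro summableI_nonneg_bounded[of _ "V 0"]) (auto intro!: mult_nonneg_nonneg simp: less_imp_le)
  \<comment> \<open>A single \<open>e j\<close> can vanish while \<open>V j\<close> does not, so two
    consecutive ones are used: (1 - t^2) p (j + 1) = t (1 - \<delta> j) e j - e (j + 1).\<close>
  define C where "C = 1 + 2 / (1 - t\<^sup>2)"
  have C: "C > 0" using t2 by (simp add: C_def add_pos_pos)
  have V_le: "V j \<le> C * ((e j)\<^sup>2 + (e (Suc j))\<^sup>2)" for j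
  proof -
    have "((1 - t\<^sup>2) * p (Suc j))\<^sup>2 = (t * (1 - \<delta> j) * e j - e (Suc j))\<^sup>2"
      unfolding e_def[of "Suc j"] step by (simp add: power2_eq_square algebra_simps)
    also have "\<dots> \<le> 2 * (t * (1 - \<delta> j) * e j)\<^sup>2 + 2 * (e (Suc j))\<^sup>2"
      using sum_squares_ge_zero[of "t * (1 - \<delta> j) * e j + e (Suc j)" 0]
      by (simp add: power2_eq_square algebra_simps)
    also have "(t * (1 - \<delta> j) * e j)\<^sup>2 \<le> (e j)\<^sup>2"
    proof -
      have "\<bar>t\<bar> * \<bar>1 - \<delta> j\<bar> * \<bar>e j\<bar> \<le> 1 * 1 * \<bar>e j\<bar>"
        using t \<delta>[of j] by (intro mult_mono) auto
      then show ?thesis by (simp add: abs_le_square_iff[symmetric] abs_mult)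
    qed
    finally have "(1 - t\<^sup>2) * ((1 - t\<^sup>2) * (p (Suc j))\<^sup>2) \<le> 2 * ((e j)\<^sup>2 + (e (Suc j))\<^sup>2)"
      by (simp add: power2_eq_square algebra_simps)
    then have "(1 - t\<^sup>2) * (p (Suc j))\<^sup>2 \<le> 2 / (1 - t\<^sup>2) * ((e j)\<^sup>2 + (e (Suc j))\<^sup>2)"
      using t2 by (simp add: field_simps)
    then show ?thesis unfolding V_def C_def distrib_right by (intro add_mono) auto
  qed
  have "c \<le> 0"
  proof (rule ccontr)
    assume "\<not> c \<le> 0"
    \<comment> \<open>If V stayed above c > 0, two consecutive damping losses would total at least k
      / (j + 1), although the losses are summable.\<close>
    define k where "k = c / C * (d / (2 + d))"
    have k: "k > 0" using C d \<open>\<not> c \<le> 0\<close> by (simp add: k_def)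
    have "k * inverse (real (Suc j)) \<le> \<delta> j * (e j)\<^sup>2 + \<delta> (Suc j) * (e (Suc j))\<^sup>2" for j
    proof -
      have "c / C \<le> (e j)\<^sup>2 + (e (Suc j))\<^sup>2"
        using order_trans[OF c(2) V_le, of j] C by (simp add: field_simps)
      moreover have "d / (2 + d) * inverse (real (Suc j)) \<le> \<delta> (Suc j)"
      proof -
        have "real (Suc j) + 1 + d \<le> (2 + d) * real (Suc j)"
          using d by (simp add: algebra_simps)
        then have "d / ((2 + d) * real (Suc j)) \<le> d / (real (Suc j) + 1 + d)"
          using d by (intro frac_le) auto
        then show ?thesis by (simp add: \<delta>_def divide_inverse mult_ac)
      qed
      ultimately have "(c / C) * (d / (2 + d) * inverse (real (Suc j)))
          \<le> ((e j)\<^sup>2 + (e (Suc j))\<^sup>2) * \<delta> (Suc j)"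
        using d by (intro mult_mono) auto
      also have "\<dots> \<le> \<delta> j * (e j)\<^sup>2 + \<delta> (Suc j) * (e (Suc j))\<^sup>2"
        using mult_right_mono[OF \<delta>(3)[of j], of "(e j)\<^sup>2"] by (simp add: algebra_simps)
      finally show ?thesis by (simp add: k_def mult_ac)
    qed
    moreover have "norm (k * inverse (real (Suc j))) = k * inverse (real (Suc j))" for j
      using k by (simp only: real_norm_def abs_mult abs_inverse abs_of_nat abs_of_pos)
    ultimately have bound: "norm (k * inverse (real (Suc j)))
        \<le> \<delta> j * (e j)\<^sup>2 + \<delta> (Suc j) * (e (Suc j))\<^sup>2" for j
      by (simp only:)
    have "summable (\<lambda>j. \<delta> (Suc j) * (e (Suc j))\<^sup>2)"
      by (rule summable_Suc_iff[THEN iffD2]) (rule summ)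
    from summable_add[OF summ this] have "summable (\<lambda>j. k * inverse (real (Suc j)))"
      by (rule summable_comparison_test') (rule bound)
    from summable_mult[OF this, of "inverse k"]
    have "summable (\<lambda>j. inverse (real (Suc j)))"
      using k by (simp only: mult.assoc[symmetric] left_inverse) simp
    then have "summable (\<lambda>j. inverse (real j))"
      using summable_Suc_iff[where f = "\<lambda>j. inverse (real j)"] by (simp only:)
    then show False using not_summable_harmonic[where 'a = real] by contradiction
  qed
  then have "c = 0" using LIMSEQ_le_const[OF c(1), of 0] V0 by auto
  have "(\<lambda>j. (p (Suc j))\<^sup>2) \<longlonglongrightarrow> 0"
  proof (rule tendsto_sandwich[OF _ _ tendsto_const])
    show "(\<lambda>j. V j / (1 - t\<^sup>2)) \<longlonglongrightarrow> 0"
      using tendsto_divide[OF c(1) tendsto_const, of "1 - t\<^sup>2"] t2 \<open>c = 0\<close> by simp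
    show "\<forall>\<^sub>F j in sequentially. (p (Suc j))\<^sup>2 \<le> V j / (1 - t\<^sup>2)"
      using t2 by (intro always_eventually allI) (simp add: V_def field_simps)
  qed auto
  then have "(\<lambda>j. p (Suc j)) \<longlonglongrightarrow> 0"
    by simp
  then show ?thesis by (simp add: filterlim_sequentially_Suc)
qed

section \<open>Functionals with ultraspherical moments\<close>

lemma smult_sum_right: "smult a (sum f A) = (\<Sum>i\<in>A. smult a (f i))"
  by (induction A rule: infinite_finite_induct) (auto simp: smult_add_right)

lemma pderiv_sum: "pderiv (sum f A) = (\<Sum>i\<in>A. pderiv (f i))"
  by (induction A rule: infinite_finite_induct) (auto simp: pderiv_add)

text \<open>The model is integration against the normalized weight (1 - x^2) ^ ((d - 1) / 2). Only
  its moments are prescribed: \<open>L_x\<close> and the recursion remove the odd ones, and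
  \<open>L_1\<close> fixes the even ones.\<close>

locale ultra_functional =
  fixes d :: real and L :: "real poly \<Rightarrow> real"
  assumes d_nonneg: "d \<ge> 0"
    and L_add: "L (p + q) = L p + L q"
    and L_smult: "L (smult c p) = c * L p"
    and L_1: "L 1 = 1"
    and L_x: "L [:0, 1:] = 0"
    and L_moment: "(real m + 2 + d) * L (monom 1 (m + 2)) = (real m + 1) * L (monom 1 m)"
begin

abbreviation "P \<equiv> ultra d"

lemma L_0 [simp]: "L 0 = 0"
  using L_smult[of 0 0] by simp

lemma L_diff: "L (p - q) = L p - L q"
  using L_add[of p "smult (-1) q"] L_smult[of "-1" q] by simp

lemma L_sum: "L (sum f A) = (\<Sum>a\<in>A. L (f a))"
  by (induction A rule: infinite_finite_induct) (auto simp: L_add)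

text \<open>Integration by parts against that weight. On monomials it is exactly the moment
  recursion, and both sides are linear in \<open>h\<close>.\<close>

lemma L_pderiv: "L ([:1, 0, -1:] * pderiv h) = (d + 1) * L ([:0, 1:] * h)"
proof -
  have mono: "L ([:1, 0, -1:] * pderiv (monom 1 m)) = (d + 1) * L ([:0, 1:] * monom 1 m)" for m
  proof (cases m)
    case 0
    then show ?thesis using L_x by (simp add: monom_0 pderiv_1 flip: one_pCons)
  next
    case (Suc i)
    have "[:1, 0, -1:] * pderiv (monom 1 m) = smult (real m) (monom 1 i - monom 1 (i + 2))"
      by (rule poly_eq_poly_eq_iff[THEN iffD1], rule ext)
        (simp add: Suc pderiv_monom poly_monom algebra_simps)
    moreover have "[:0, 1:] * monom 1 m = (monom 1 (i + 2) :: real poly)"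
      by (simp add: Suc monom_Suc)
    ultimately show ?thesis
      using L_moment[of i] by (simp add: L_smult L_diff Suc algebra_simps)
  qed
  have "h = (\<Sum>i\<le>degree h. smult (coeff h i) (monom 1 i))"
    using poly_as_sum_of_monoms[of h] by (simp add: smult_monom)
  then obtain N c where h: "h = (\<Sum>i\<le>N. smult (c i) (monom 1 i))" by blast
  have "(\<Sum>i\<le>N. c i * ((d + 1) * L ([:0, 1:] * monom 1 i)))
      = (d + 1) * (\<Sum>i\<le>N. c i * L ([:0, 1:] * monom 1 i))"
    unfolding sum_distrib_left by (simp only: mult.left_commute)
  then show ?thesis
    by (simp only: h pderiv_sum pderiv_smult sum_distrib_left[of "_ :: real poly"] mult_smult_right
        L_sum L_smult mono)
qed

text \<open>Applying \<open>L\<close> to \<open>pderiv_ultra\<close> and integrating by parts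
  relates L (x P (i + 1)) to L (P i); the recurrence then makes L (P (i + 2)) a multiple of that
  value.\<close>

lemma L_ultra: "L (P (Suc j)) = 0"
proof (induction j rule: less_induct)
  case (less j)
  show ?case
  proof (cases j)
    case 0
    then show ?thesis using L_x by simp
  next
    case (Suc i)
    let ?X = "[:0, 1 :: real:]"
    have rec: "smult (real i + 1 + d) (P (Suc (Suc i)))
        = smult (2 * real i + 2 + d) (?X * P (Suc i)) - smult (real i + 1) (P i)"
      using d_nonneg by simp
    have "[:1, 0, -1:] * pderiv (P (Suc i)) = smult (real i + 1) (P i - ?X * P (Suc i))"
      by (rule poly_eq_poly_eq_iff[THEN iffD1], rule ext)
        (use pderiv_ultra[OF d_nonneg, of _ i] in \<open>simp del: ultra.simps add: power2_eq_square algebra_simps\<close>)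
    from arg_cong[OF this, of L]
    have "(d + 1) * L (?X * P (Suc i)) = (real i + 1) * (L (P i) - L (?X * P (Suc i)))"
      unfolding L_pderiv by (simp add: L_smult L_diff del: mult_pCons_left)
    then have 1: "(real i + 2 + d) * L (?X * P (Suc i)) = (real i + 1) * L (P i)"
      by (simp add: algebra_simps)
    have 2: "(real i + 1 + d) * L (P (Suc (Suc i)))
        = (2 * real i + 2 + d) * L (?X * P (Suc i)) - (real i + 1) * L (P i)"
      using arg_cong[OF rec, of L] by (simp add: L_smult L_diff del: mult_pCons_left ultra.simps)
    have "(real i + 1 + d) * L (P (Suc (Suc i))) = real i * L (?X * P (Suc i))"
      using 1 2 by (simp add: algebra_simps)
    \<comment> \<open>For i = 0 the factor i is essential, because L (P 0) = 1; for i > 0 the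
      induction hypothesis applies to P i.\<close>
    also have "\<dots> = 0"
    proof (cases i)
      case (Suc k)
      then have "L (P i) = 0" using less[of k] \<open>j = Suc i\<close> by simp
      then have "L (?X * P (Suc i)) = 0" using 1 d_nonneg by auto
      then show ?thesis by simp
    qed simp
    finally show ?thesis using Suc d_nonneg by (simp del: ultra.simps)
  qed
qed

text \<open>One factor x at a time is moved onto \<open>P j\<close>. This yields the indices j - 1
  and j + 1, both still above the remaining exponent.\<close>

lemma L_monom_ultra: "i < j \<Longrightarrow> L (monom 1 i * P j) = 0"
proof (induction i arbitrary: j)
  case 0
  then show ?case using L_ultra[of "j - 1"] by (simp add: monom_0 flip: one_pCons)
next
  case (Suc i)
  then obtain k where j: "j = Suc k" by (cases j) auto
  have "monom 1 (Suc i) * P j = monom 1 i * ([:0, 1:] * P j)"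
    by (simp add: monom_Suc)
  also have "\<dots> = smult ((real k + 1 + d) / (2 * real k + 2 + d)) (monom 1 i * P (Suc j))
      + smult ((real k + 1) / (2 * real k + 2 + d)) (monom 1 i * P k)"
    unfolding j x_times_ultra[OF d_nonneg] by (simp add: algebra_simps del: ultra.simps)
  finally show ?case
    using Suc j by (simp add: L_add L_smult del: ultra.simps)
qed

lemma L_mult_ultra:
  assumes "degree q < j"
  shows "L (q * P j) = 0"
proof -
  have "q = (\<Sum>i\<le>degree q. smult (coeff q i) (monom 1 i))"
    using poly_as_sum_of_monoms[of q] by (simp add: smult_monom)
  then have "L (q * P j) = L (\<Sum>i\<le>degree q. smult (coeff q i) (monom 1 i * P j))"
    by (metis (no_types, lifting) mult_smult_left sum.cong sum_distrib_right)
  also have "\<dots> = 0"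
    unfolding L_sum L_smult by (intro sum.neutral ballI) (use assms in \<open>auto simp: L_monom_ultra\<close>)
  finally show ?thesis .
qed

lemma L_ultra_ultra: "i \<noteq> j \<Longrightarrow> L (P i * P j) = 0"
  using L_mult_ultra[of "P i" j] L_mult_ultra[of "P j" i] degree_ultra[of d i] degree_ultra[of d j]
  by (cases i j rule: linorder_cases) (auto simp: mult.commute)

section \<open>Norms, nonnegative combinations and finite expansions\<close>

definition \<nu> :: "nat \<Rightarrow> real" where "\<nu> j = L (P j * P j)"

lemma \<nu>_0 [simp]: "\<nu> 0 = 1"
  by (simp add: \<nu>_def L_1)

text \<open>\<open>L\<close> is not assumed positive. Computing L (x P j P (j + 1)) by multiplying x
  into either factor gives positive multiples of \<open>\<nu> j\<close> and of
  \<open>\<nu> (Suc j)\<close>, which are therefore of the same sign.\<close>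

lemma \<nu>_pos: "\<nu> j > 0"
proof (induction j)
  case (Suc j)
  let ?X = "[:0, 1 :: real:]"
  have "?X * P j * P (Suc j) = P j * (?X * P (Suc j))" by (simp only: mult_ac)
  also have "\<dots> = smult ((real j + 1 + d) / (2 * real j + 2 + d)) (P j * P (Suc (Suc j)))
      + smult ((real j + 1) / (2 * real j + 2 + d)) (P j * P j)"
    unfolding x_times_ultra[OF d_nonneg] by (simp add: algebra_simps del: ultra.simps)
  finally have 1: "L (?X * P j * P (Suc j)) = (real j + 1) / (2 * real j + 2 + d) * \<nu> j"
    by (simp add: L_add L_smult L_ultra_ultra \<nu>_def del: ultra.simps mult_pCons_left)
  have "\<exists>a b q. a > 0 \<and> ?X * P j = smult a (P (Suc j)) + smult b (P q) \<and> q \<noteq> Suc j"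
  proof (cases j)
    case 0
    then show ?thesis by (intro exI[of _ 1] exI[of _ 0]) auto
  next
    case (Suc i)
    have "(real i + 1 + d) / (2 * real i + 2 + d) > 0" using d_nonneg by simp
    then show ?thesis using x_times_ultra[OF d_nonneg, of i] unfolding Suc
      by (intro exI[of _ "(real i + 1 + d) / (2 * real i + 2 + d)"]
          exI[of _ "(real i + 1) / (2 * real i + 2 + d)"] exI[of _ i] conjI) (simp_all del: ultra.simps mult_pCons_left)
  qed
  then obtain a b q where abq: "a > 0" "?X * P j = smult a (P (Suc j)) + smult b (P q)" "q \<noteq> Suc j"
    by blast
  have "L (?X * P j * P (Suc j)) = a * \<nu> (Suc j)"
    unfolding abq(2) using abq(3)
    by (simp add: distrib_right L_add L_smult L_ultra_ultra \<nu>_def del: ultra.simps)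
  moreover have "(real j + 1) / (2 * real j + 2 + d) * \<nu> j > 0"
    using Suc d_nonneg by (intro mult_pos_pos divide_pos_pos) auto
  ultimately have "a * \<nu> (Suc j) > 0" using 1 by linarith
  then show ?case using abq(1) by (simp add: zero_less_mult_iff)
qed simp

definition ultra_cone :: "nat \<Rightarrow> real poly set" where
  "ultra_cone N = {\<Sum>l\<le>N. smult (c l) (P l) | c. \<forall>l. c l \<ge> (0 :: real)}"

lemma ultra_cone_add:
  assumes "p \<in> ultra_cone N" "q \<in> ultra_cone N"
  shows "p + q \<in> ultra_cone N"
proof -
  obtain b c where "\<forall>l. b l \<ge> 0" "p = (\<Sum>l\<le>N. smult (b l) (P l))"
    "\<forall>l. c l \<ge> 0" "q = (\<Sum>l\<le>N. smult (c l) (P l))"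
    using assms by (auto simp: ultra_cone_def)
  then show ?thesis unfolding ultra_cone_def
    by (intro CollectI exI[of _ "\<lambda>l. b l + c l"]) (auto simp: sum.distrib smult_add_left)
qed

lemma ultra_cone_smult:
  assumes "a \<ge> 0" "p \<in> ultra_cone N"
  shows "smult a p \<in> ultra_cone N"
proof -
  obtain b where "\<forall>l. b l \<ge> 0" "p = (\<Sum>l\<le>N. smult (b l) (P l))"
    using assms by (auto simp: ultra_cone_def)
  then show ?thesis unfolding ultra_cone_def using assms
    by (intro CollectI exI[of _ "\<lambda>l. a * b l"]) (auto simp: smult_sum_right)
qed

lemma ultra_cone_sum: "(\<And>i. i \<in> A \<Longrightarrow> f i \<in> ultra_cone N) \<Longrightarrow> sum f A \<in> ultra_cone N"
proof (induction A rule: infinite_finite_induct)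
  case (infinite A)
  then show ?case by (auto simp: ultra_cone_def intro!: exI[of _ "\<lambda>_. 0"])
next
  case empty
  then show ?case by (auto simp: ultra_cone_def intro!: exI[of _ "\<lambda>_. 0"])
qed (auto intro: ultra_cone_add)

lemma ultra_in_cone: "l \<le> N \<Longrightarrow> P l \<in> ultra_cone N"
  unfolding ultra_cone_def
  by (intro CollectI exI[of _ "\<lambda>i. if i = l then 1 else 0"]) (auto simp: if_distrib[of "\<lambda>c. smult c _"] sum.delta cong: if_cong)

lemma x_times_cone:
  assumes "p \<in> ultra_cone N"
  shows "[:0, 1:] * p \<in> ultra_cone (Suc N)"
proof -
  obtain c where c: "\<forall>l. c l \<ge> 0" "p = (\<Sum>l\<le>N. smult (c l) (P l))"
    using assms by (auto simp: ultra_cone_def)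
  have *: "[:0, 1:] * P l \<in> ultra_cone (Suc N)" if "l \<le> N" for l
  proof (cases l)
    case 0
    then show ?thesis using ultra_in_cone[of "Suc 0" "Suc N"] by simp
  next
    case (Suc k)
    show ?thesis unfolding Suc x_times_ultra[OF d_nonneg] using that Suc d_nonneg
      by (intro ultra_cone_add ultra_cone_smult ultra_in_cone) auto
  qed
  have "[:0, 1:] * p = (\<Sum>l\<le>N. smult (c l) ([:0, 1:] * P l))"
    unfolding c(2) sum_distrib_left mult_smult_right ..
  also have "\<dots> \<in> ultra_cone (Suc N)"
    using * c(1) by (intro ultra_cone_sum ultra_cone_smult) auto
  finally show ?thesis .
qed

text \<open>Multiplication by x preserves nonnegative coefficients, so starting from 1 all powers
  have them. This is why the peaked kernels are built from monomials.\<close>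

lemma monom_in_cone: "monom 1 i \<in> ultra_cone i"
proof (induction i)
  case 0
  show ?case using ultra_in_cone[of 0 0] by (simp add: monom_0 flip: one_pCons)
next
  case (Suc i)
  then show ?case using x_times_cone[of "monom 1 i" i] by (simp add: monom_Suc)
qed

lemma ultra_cone_mono: "M \<le> N \<Longrightarrow> ultra_cone M \<subseteq> ultra_cone N"
proof
  fix p assume MN: "M \<le> N" and "p \<in> ultra_cone M"
  then obtain c where c: "\<forall>l. c l \<ge> 0" "p = (\<Sum>l\<le>M. smult (c l) (P l))"
    by (auto simp: ultra_cone_def)
  have "p = (\<Sum>l\<le>N. smult (if l \<le> M then c l else 0) (P l))"
    unfolding c(2) using MN by (intro sum.mono_neutral_cong_left) auto
  then show "p \<in> ultra_cone N" using c(1) unfolding ultra_cone_def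
    by (intro CollectI exI[of _ "\<lambda>l. if l \<le> M then c l else 0"]) auto
qed

lemma L_ultra_sum:
  "L ((\<Sum>l\<le>N. smult (c l) (P l)) * P j) = (if j \<le> N then c j * \<nu> j else 0)"
proof -
  have "L ((\<Sum>l\<le>N. smult (c l) (P l)) * P j) = (\<Sum>l\<le>N. c l * L (P l * P j))"
    by (simp add: sum_distrib_right L_sum L_smult)
  also have "\<dots> = (\<Sum>l\<le>N. if l = j then c j * \<nu> j else 0)"
    by (intro sum.cong) (auto simp: L_ultra_ultra \<nu>_def)
  finally show ?thesis by simp
qed

text \<open>Monomials lie in the span of the \<open>P l\<close>, so some expansion exists;
  orthogonality identifies its coefficients.\<close>

lemma ultra_expansion:
  assumes "degree p \<le> N"
  shows "p = (\<Sum>l\<le>N. smult (L (p * P l) / \<nu> l) (P l))"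
proof -
  have "\<exists>c. monom 1 i = (\<Sum>l\<le>N. smult (c l) (P l))" if "i \<le> N" for i
    using monom_in_cone[of i] ultra_cone_mono[OF that] by (auto simp: ultra_cone_def)
  then obtain b where b: "monom 1 i = (\<Sum>l\<le>N. smult (b i l) (P l))" if "i \<le> N" for i
    by metis
  define c where "c l = (\<Sum>i\<le>N. coeff p i * b i l)" for l
  have "p = (\<Sum>i\<le>N. smult (coeff p i) (monom 1 i))"
    using poly_as_sum_of_monoms'[OF assms] by (simp add: smult_monom)
  also have "\<dots> = (\<Sum>i\<le>N. \<Sum>l\<le>N. smult (coeff p i * b i l) (P l))"
    by (intro sum.cong) (auto simp: b smult_sum_right)
  also have "\<dots> = (\<Sum>l\<le>N. smult (c l) (P l))"
    by (subst sum.swap) (simp add: c_def smult_sum)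
  finally have p: "p = (\<Sum>l\<le>N. smult (c l) (P l))" .
  have "c l = L (p * P l) / \<nu> l" if "l \<le> N" for l
    using that \<nu>_pos[of l] by (simp add: p L_ultra_sum)
  then have "(\<Sum>l\<le>N. smult (c l) (P l)) = (\<Sum>l\<le>N. smult (L (p * P l) / \<nu> l) (P l))"
    by (intro sum.cong) auto
  with p show ?thesis by (rule trans)
qed

end

section \<open>Moments of the sphere measure\<close>

interpretation lborel_product: product_sigma_finite "\<lambda>_::nat. lborel :: real measure" ..

lemma vnorm_measurable [measurable]: "vnorm n \<in> borel_measurable (lebesgue_n n)"
  unfolding vnorm_def by measurable

lemma vdot_measurable [measurable]: "vdot n v \<in> borel_measurable (lebesgue_n n)"
  unfolding vdot_def by measurable

lemma radial_proj_measurable [measurable]: "radial_proj n \<in> measurable (lebesgue_n n) (lebesgue_n n)"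
  unfolding radial_proj_def by measurable

lemma unit_ball_sets [measurable]: "unit_ball n \<in> sets (lebesgue_n n)"
  unfolding unit_ball_def by measurable

lemma unit_sphere_sets [measurable]: "unit_sphere n \<in> sets (lebesgue_n n)"
  unfolding unit_sphere_def by measurable

lemma emeasure_unit_ball: "emeasure (lebesgue_n n) (unit_ball n) = ennreal (unit_ball_vol (real n))"
proof -
  have "unit_ball n = {f. sqrt (\<Sum>i\<in>{..<n}. (f i)\<^sup>2) \<le> 1} \<inter> space (lebesgue_n n)"
    by (auto simp: unit_ball_def vnorm_def)
  then show ?thesis using emeasure_cball_aux[of "{..<n}" 1] by simp
qed

lemma vnorm_nonneg: "vnorm n x \<ge> 0"
  by (simp add: vnorm_def sum_nonneg)

lemma vnorm_scale: "vnorm n (\<lambda>i\<in>{..<n}. c * x i) = \<bar>c\<bar> * vnorm n x"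
  by (simp add: vnorm_def power_mult_distrib sum_distrib_left[symmetric] real_sqrt_mult)

lemma vdot_scale: "vdot n v (\<lambda>i\<in>{..<n}. c * x i) = c * vdot n v x"
  by (simp add: vdot_def sum_distrib_left mult_ac)

lemma vdot_radial_proj: "vdot n v (radial_proj n x) = vdot n v x / vnorm n x"
  by (simp add: vdot_def radial_proj_def sum_divide_distrib)

section \<open>Polar coordinates obtained from scaling\<close>

lemma lebesgue_n_scale:
  assumes "c \<noteq> 0"
  shows "lebesgue_n n = density (distr (lebesgue_n n) (lebesgue_n n) (\<lambda>x. \<lambda>i\<in>{..<n}. c * x i))
    (\<lambda>_. ennreal (\<bar>c\<bar> ^ n))" (is "_ = density (distr _ _ ?s) _")
proof (rule sym, rule lborel_product.PiM_eqI)
  fix A :: "nat \<Rightarrow> real set"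
  assume A: "\<And>i. i \<in> {..<n} \<Longrightarrow> A i \<in> sets lborel"
  have [measurable]: "?s \<in> measurable (lebesgue_n n) (lebesgue_n n)" by measurable
  have box: "Pi\<^sub>E {..<n} A \<in> sets (lebesgue_n n)"
    using A by (intro sets_PiM_I_finite) auto
  have "?s -` Pi\<^sub>E {..<n} A \<inter> space (lebesgue_n n) = (\<Pi>\<^sub>E i\<in>{..<n}. (\<lambda>y. c * y) -` A i)"
    by (auto simp: space_PiM PiE_iff extensional_def)
  moreover have "(\<lambda>y. c * y) -` A i \<in> sets lborel" if "i < n" for i
    using A[of i] that measurable_sets[of "\<lambda>y. c * y" lborel borel "A i"] by simp
  moreover from this have "emeasure (lebesgue_n n) (\<Pi>\<^sub>E i\<in>{..<n}. (\<lambda>y. c * y) -` A i)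
      = (\<Prod>i<n. emeasure lborel ((\<lambda>y. c * y) -` A i))"
    by (intro lborel_product.emeasure_PiM) auto
  ultimately have "emeasure (density (distr (lebesgue_n n) (lebesgue_n n) ?s) (\<lambda>_. ennreal (\<bar>c\<bar> ^ n))) (Pi\<^sub>E {..<n} A)
      = ennreal (\<bar>c\<bar> ^ n) * (\<Prod>i<n. emeasure lborel ((\<lambda>y. c * y) -` A i))"
    using box by (simp add: emeasure_density_const emeasure_distr)
  also have "\<dots> = (\<Prod>i<n. ennreal \<bar>c\<bar> * emeasure lborel ((\<lambda>y. c * y) -` A i))"
    by (simp add: prod.distrib ennreal_power)
  also have "\<dots> = (\<Prod>i<n. emeasure lborel (A i))"
  proof (intro prod.cong refl)
    fix i assume "i \<in> {..<n}"
    then have "A i \<in> sets borel" using A by simp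
    then show "ennreal \<bar>c\<bar> * emeasure lborel ((\<lambda>y. c * y) -` A i) = emeasure lborel (A i)"
      by (subst (2) lborel_real_affine[OF assms, of 0]) (simp add: emeasure_density_const emeasure_distr)
  qed
  finally show "emeasure (density (distr (lebesgue_n n) (lebesgue_n n) ?s) (\<lambda>_. ennreal (\<bar>c\<bar> ^ n))) (Pi\<^sub>E {..<n} A)
      = (\<Prod>i<n. emeasure lborel (A i))" .
qed auto

lemma nn_integral_lebesgue_n_scale:
  assumes "c \<noteq> 0" and [measurable]: "f \<in> borel_measurable (lebesgue_n n)"
  shows "(\<integral>\<^sup>+x. f x \<partial>lebesgue_n n)
    = ennreal (\<bar>c\<bar> ^ n) * (\<integral>\<^sup>+x. f (\<lambda>i\<in>{..<n}. c * x i) \<partial>lebesgue_n n)"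
proof -
  have [measurable]: "(\<lambda>x. \<lambda>i\<in>{..<n}. c * x i) \<in> measurable (lebesgue_n n) (lebesgue_n n)" by measurable
  show ?thesis
    by (subst lebesgue_n_scale[OF assms(1)]) (simp add: nn_integral_density nn_integral_distr nn_integral_cmult)
qed

lemma AE_vnorm_nonzero:
  assumes "n \<ge> 1"
  shows "AE x in lebesgue_n n. vnorm n x \<noteq> 0"
proof -
  define Z where "Z = (\<Pi>\<^sub>E i\<in>{..<n}. {0::real})"
  have Z: "Z \<in> sets (lebesgue_n n)"
    unfolding Z_def by (intro sets_PiM_I_finite) auto
  have "emeasure (lebesgue_n n) Z = (\<Prod>i<n. emeasure lborel {0::real})"
    unfolding Z_def by (rule lborel_product.emeasure_PiM) auto
  also have "\<dots> = 0" using assms by auto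
  finally have "AE x in lebesgue_n n. x \<notin> Z"
    using Z by (intro AE_not_in) auto
  moreover have "x \<in> Z" if "x \<in> space (lebesgue_n n)" "vnorm n x = 0" for x
    using that by (auto simp: Z_def vnorm_def sum_nonneg_eq_0_iff space_PiM PiE_iff extensional_def)
  ultimately show ?thesis by (auto elim!: AE_mp)
qed

text \<open>Scaling by r carries the unit ball to the ball of radius r and leaves \<open>h\<close>
  unchanged. For r \<le> 0 only the origin could contribute, a null set as n \<ge> 1.\<close>

lemma distr_vnorm_scale_invariant:
  assumes "n \<ge> 1"
    and [measurable]: "h \<in> borel_measurable (lebesgue_n n)"
    and inv: "\<And>r x. r > 0 \<Longrightarrow> x \<in> space (lebesgue_n n) \<Longrightarrow> h (\<lambda>i\<in>{..<n}. r * x i) = h x"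
  shows "emeasure (distr (density (lebesgue_n n) h) borel (vnorm n)) {..r}
    = ennreal (max 0 r ^ n) * (\<integral>\<^sup>+x. h x * indicator (unit_ball n) x \<partial>lebesgue_n n)"
proof -
  have eq: "emeasure (distr (density (lebesgue_n n) h) borel (vnorm n)) {..r}
    = (\<integral>\<^sup>+x. h x * indicator {..r} (vnorm n x) \<partial>lebesgue_n n)"
    by (subst emeasure_distr) (auto simp: emeasure_density intro!: nn_integral_cong split: split_indicator)
  show ?thesis
  proof (cases "r > 0")
    case True
    have "(\<integral>\<^sup>+x. h x * indicator {..r} (vnorm n x) \<partial>lebesgue_n n)
      = ennreal (\<bar>r\<bar> ^ n) * (\<integral>\<^sup>+x. h (\<lambda>i\<in>{..<n}. r * x i) * indicator {..r} (vnorm n (\<lambda>i\<in>{..<n}. r * x i)) \<partial>lebesgue_n n)"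
      using True by (intro nn_integral_lebesgue_n_scale) auto
    also have "(\<integral>\<^sup>+x. h (\<lambda>i\<in>{..<n}. r * x i) * indicator {..r} (vnorm n (\<lambda>i\<in>{..<n}. r * x i)) \<partial>lebesgue_n n)
        = (\<integral>\<^sup>+x. h x * indicator (unit_ball n) x \<partial>lebesgue_n n)"
      using True by (intro nn_integral_cong) (auto simp: inv vnorm_scale unit_ball_def split: split_indicator)
    finally show ?thesis using True eq by (simp add: max_def)
  next
    case False
    have "(\<integral>\<^sup>+x. h x * indicator {..r} (vnorm n x) \<partial>lebesgue_n n) = (\<integral>\<^sup>+x. 0 \<partial>lebesgue_n n)"
    proof (rule nn_integral_cong_AE, rule AE_mp[OF AE_vnorm_nonzero[OF assms(1)]], rule AE_I2, rule impI)
      fix x assume "vnorm n x \<noteq> 0"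
      then have "vnorm n x > r" using vnorm_nonneg[of n x] False by linarith
      then show "h x * indicator {..r} (vnorm n x) = 0" by simp
    qed
    then show ?thesis using False eq assms(1) by (simp add: max_def)
  qed
qed

text \<open>Radius and direction are independent under Lebesgue measure.\<close>

lemma nn_integral_scale_invariant:
  assumes n: "n \<ge> 1"
    and [measurable]: "h \<in> borel_measurable (lebesgue_n n)" "\<psi> \<in> borel_measurable borel"
    and inv: "\<And>r x. r > 0 \<Longrightarrow> x \<in> space (lebesgue_n n) \<Longrightarrow> h (\<lambda>i\<in>{..<n}. r * x i) = h x"
    and fin: "(\<integral>\<^sup>+x. h x * indicator (unit_ball n) x \<partial>lebesgue_n n) < \<infinity>"
  shows "ennreal (unit_ball_vol (real n)) * (\<integral>\<^sup>+x. h x * \<psi> (vnorm n x) \<partial>lebesgue_n n)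
    = (\<integral>\<^sup>+x. h x * indicator (unit_ball n) x \<partial>lebesgue_n n) * (\<integral>\<^sup>+x. \<psi> (vnorm n x) \<partial>lebesgue_n n)"
proof -
  define a where "a = ennreal (unit_ball_vol (real n))"
  define b where "b = (\<integral>\<^sup>+x. h x * indicator (unit_ball n) x \<partial>lebesgue_n n)"
  let ?D = "\<lambda>f. distr (density (lebesgue_n n) f) borel (vnorm n)"
  \<comment> \<open>Cross-multiplied so that both densities give every ball centred at the origin
    the same mass; the two laws of the norm then agree on half-lines and hence coincide.\<close>
  have D: "emeasure (?D f) {..r} = ennreal (max 0 r ^ n) * (a * b)" if "f = (\<lambda>x. a * h x) \<or> f = (\<lambda>_. b)" for f r
  proof -
    have "emeasure (?D f) {..r} = ennreal (max 0 r ^ n) * (\<integral>\<^sup>+x. f x * indicator (unit_ball n) x \<partial>lebesgue_n n)"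
      using that by (intro distr_vnorm_scale_invariant[OF n]) (auto simp: inv)
    also have "(\<integral>\<^sup>+x. f x * indicator (unit_ball n) x \<partial>lebesgue_n n) = a * b"
      using that
    proof
      assume "f = (\<lambda>x. a * h x)"
      then show ?thesis by (simp add: mult.assoc nn_integral_cmult b_def)
    next
      assume "f = (\<lambda>_. b)"
      then show ?thesis
        by (simp add: nn_integral_cmult_indicator emeasure_unit_ball a_def mult.commute)
    qed
    finally show ?thesis .
  qed
  have sets: "sets (borel :: real measure) = sigma_sets UNIV (range atMost)"
    by (subst borel_eq_atMost) simp
  have "?D (\<lambda>x. a * h x) = ?D (\<lambda>_. b)"
  proof (rule measure_eqI_generator_eq[where E = "range atMost" and \<Omega> = UNIV and A = "\<lambda>i. {..real i}"])
    show "Int_stable (range atMost :: real set set)"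
      by (auto simp: Int_stable_def)
    show "(\<Union>i. {..real i}) = UNIV"
      using real_arch_simple by auto
    show "emeasure (?D (\<lambda>x. a * h x)) {..real i} \<noteq> \<infinity>" for i
      using fin by (simp add: D b_def[symmetric] a_def ennreal_mult_eq_top_iff)
  qed (auto simp: D sets)
  then have "(\<integral>\<^sup>+r. \<psi> r \<partial>?D (\<lambda>x. a * h x)) = (\<integral>\<^sup>+r. \<psi> r \<partial>?D (\<lambda>_. b))" by simp
  then show ?thesis
    by (simp add: nn_integral_distr nn_integral_density nn_integral_cmult mult.assoc a_def b_def)
qed

text \<open>Connects the product form, where characteristic functions multiply, with the density
  form, where polar coordinates apply.\<close>

lemma PiM_std_normal:
  "(\<Pi>\<^sub>M i\<in>{..<n}. density lborel std_normal_density)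
    = density (lebesgue_n n) (\<lambda>x. ennreal (\<Prod>i<n. std_normal_density (x i)))"
proof -
  interpret N1: prob_space "density lborel std_normal_density"
    by (rule prob_space_normal_density) simp
  interpret N: product_prob_space "\<lambda>_::nat. density lborel std_normal_density" "{..<n}"
    by unfold_locales
  have sets: "sets (\<Pi>\<^sub>M i\<in>{..<n}. density lborel std_normal_density) = sets (lebesgue_n n)"
    by (rule sets_PiM_cong) auto
  show ?thesis
  proof (rule sym, rule N.PiM_eqI)
    fix A :: "nat \<Rightarrow> real set"
    assume A: "\<And>i. i \<in> {..<n} \<Longrightarrow> A i \<in> sets (density lborel std_normal_density)"
    then have "Pi\<^sub>E {..<n} A \<in> sets (lebesgue_n n)"
      by (intro sets_PiM_I_finite) auto
    then have "emeasure (density (lebesgue_n n) (\<lambda>x. ennreal (\<Prod>i<n. std_normal_density (x i)))) (Pi\<^sub>E {..<n} A)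
       = (\<integral>\<^sup>+x. ennreal (\<Prod>i<n. std_normal_density (x i)) * indicator (Pi\<^sub>E {..<n} A) x \<partial>lebesgue_n n)"
      by (subst emeasure_density) auto
    also have "\<dots> = (\<integral>\<^sup>+x. (\<Prod>i<n. ennreal (std_normal_density (x i)) * indicator (A i) (x i)) \<partial>lebesgue_n n)"
    proof (rule nn_integral_cong)
      fix x assume x: "x \<in> space (lebesgue_n n)"
      have "indicator (Pi\<^sub>E {..<n} A) x = (\<Prod>i<n. indicator (A i) (x i) :: ennreal)"
        using x by (auto simp: space_PiM PiE_iff indicator_def prod_zero_iff intro!: prod.neutral)
      then show "ennreal (\<Prod>i<n. std_normal_density (x i)) * indicator (Pi\<^sub>E {..<n} A) x
        = (\<Prod>i<n. ennreal (std_normal_density (x i)) * indicator (A i) (x i))"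
        by (simp add: prod.distrib prod_ennreal[symmetric])
    qed
    also have "\<dots> = (\<Prod>i<n. \<integral>\<^sup>+x. ennreal (std_normal_density x) * indicator (A i) x \<partial>lborel)"
      using A by (intro lborel_product.product_nn_integral_prod) auto
    also have "\<dots> = (\<Prod>i<n. emeasure (density lborel std_normal_density) (A i))"
      using A by (intro prod.cong) (auto simp: emeasure_density)
    finally show "emeasure (density (lebesgue_n n) (\<lambda>x. ennreal (\<Prod>i<n. std_normal_density (x i)))) (Pi\<^sub>E {..<n} A)
      = (\<Prod>i<n. emeasure (density lborel std_normal_density) (A i))" .
  qed (use sets in auto)
qed

text \<open>The characteristic function is a product of Gaussian factors in which only the sum of
  the squares of the v i survives. This is where rotation invariance enters.\<close>

lemma distr_vdot_std_normal:
  "distr (\<Pi>\<^sub>M i\<in>{..<n}. std_normal_distribution) borel (vdot n v)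
    = distr std_normal_distribution borel (\<lambda>u. vnorm n v * u)"
proof -
  let ?N = "std_normal_distribution"
  interpret N1: prob_space ?N by (rule prob_space_normal_density) simp
  interpret N: product_prob_space "\<lambda>_::nat. ?N" "{..<n}" by unfold_locales
  have char_N: "(CLINT u|?N. iexp (a * u)) = exp (- complex_of_real (a\<^sup>2) / 2)" for a
    using fun_cong[OF char_std_normal_distribution, of a] by (simp add: char_def exp_of_real[symmetric])
  have [measurable]: "vdot n v \<in> borel_measurable (\<Pi>\<^sub>M i\<in>{..<n}. ?N)"
    unfolding vdot_def by measurable
  show ?thesis
  proof (rule Levy_uniqueness)
    show "real_distribution (distr (\<Pi>\<^sub>M i\<in>{..<n}. ?N) borel (vdot n v))"
      by (intro N.P.real_distribution_distr) simp
    show "real_distribution (distr ?N borel (\<lambda>u. vnorm n v * u))"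
      by (intro N1.real_distribution_distr) simp
    show "char (distr (\<Pi>\<^sub>M i\<in>{..<n}. ?N) borel (vdot n v)) = char (distr ?N borel (\<lambda>u. vnorm n v * u))"
    proof
      fix a
      have "char (distr (\<Pi>\<^sub>M i\<in>{..<n}. ?N) borel (vdot n v)) a
        = (CLINT x|(\<Pi>\<^sub>M i\<in>{..<n}. ?N). iexp (a * vdot n v x))"
        unfolding char_def by (subst integral_distr) auto
      also have "\<dots> = (CLINT x|(\<Pi>\<^sub>M i\<in>{..<n}. ?N). (\<Prod>i<n. iexp ((a * v i) * x i)))"
        by (simp add: vdot_def sum_distrib_left exp_sum[symmetric] mult_ac)
      also have "\<dots> = (\<Prod>i<n. CLINT u|?N. iexp ((a * v i) * u))"
        by (intro N.product_integral_prod N1.integrable_iexp) auto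
      also have "\<dots> = exp (- complex_of_real ((a * vnorm n v)\<^sup>2) / 2)"
        unfolding char_N exp_sum[symmetric, OF finite_lessThan]
        by (simp add: vnorm_def sum_nonneg power_mult_distrib sum_distrib_left sum_divide_distrib sum_negf[symmetric])
      also have "\<dots> = char (distr ?N borel (\<lambda>u. vnorm n v * u)) a"
        unfolding char_N[symmetric] char_def by (subst integral_distr) (auto simp: mult_ac)
      finally show "char (distr (\<Pi>\<^sub>M i\<in>{..<n}. ?N) borel (vdot n v)) a
        = char (distr ?N borel (\<lambda>u. vnorm n v * u)) a" .
    qed
  qed
qed


lemma abs_vdot_radial_proj_le: "\<bar>vdot n v (radial_proj n x)\<bar> \<le> (\<Sum>i<n. \<bar>v i\<bar>)"
proof -
  have "\<bar>radial_proj n x i\<bar> \<le> 1" if "i < n" for i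
  proof -
    have "(x i)\<^sup>2 \<le> (\<Sum>i<n. (x i)\<^sup>2)"
      using that by (intro member_le_sum) auto
    then have "\<bar>x i\<bar> \<le> vnorm n x"
      unfolding vnorm_def by (intro real_le_rsqrt) simp
    then show ?thesis using that vnorm_nonneg[of n x]
      by (cases "vnorm n x = 0") (auto simp: radial_proj_def)
  qed
  then have "\<bar>v i * radial_proj n x i\<bar> \<le> \<bar>v i\<bar>" if "i < n" for i
    using that mult_left_mono[of "\<bar>radial_proj n x i\<bar>" 1 "\<bar>v i\<bar>"] by (simp add: abs_mult)
  then show ?thesis
    unfolding vdot_def by (intro order_trans[OF sum_abs] sum_mono) auto
qed

lemma nn_integral_sphere:
  assumes n: "n \<ge> 1" and [measurable]: "f \<in> borel_measurable (lebesgue_n n)"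
  shows "(\<integral>\<^sup>+x. f x \<partial>sphere_measure n)
    = (\<integral>\<^sup>+x. f (radial_proj n x) * indicator (unit_ball n) x \<partial>lebesgue_n n) / ennreal (unit_ball_vol (real n))"
proof -
  let ?U = "uniform_measure (lebesgue_n n) (unit_ball n)"
  let ?D = "distr ?U (lebesgue_n n) (radial_proj n)"
  interpret prob_space "sphere_measure n" by (rule prob_space_sphere_measure[OF n])
  have vol: "unit_ball_vol (real n) \<noteq> 0"
    using less_imp_neq[OF unit_ball_vol_pos[of "real n"]] by simp
  interpret U: prob_space ?U
    by (rule prob_space_uniform_measure) (use vol in \<open>simp_all add: emeasure_unit_ball\<close>)
  have [measurable]: "radial_proj n \<in> measurable ?U (lebesgue_n n)" by simp
  interpret D: prob_space ?D
    by (rule U.prob_space_distr) simp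
  have "emeasure ?D (unit_sphere n) = 1"
    using emeasure_space_1 unfolding space_sphere_measure
    by (simp add: sphere_measure_def emeasure_restrict_space)
  then have "AE x in ?D. x \<in> unit_sphere n"
    by (intro D.AE_prob_1) (simp add: D.emeasure_eq_measure)
  then have "(\<integral>\<^sup>+x. f x * indicator (unit_sphere n) x \<partial>?D) = (\<integral>\<^sup>+x. f x \<partial>?D)"
    by (intro nn_integral_cong_AE) auto
  then have "(\<integral>\<^sup>+x. f x \<partial>sphere_measure n) = (\<integral>\<^sup>+x. f x \<partial>?D)"
    unfolding sphere_measure_def by (subst nn_integral_restrict_space) auto
  also have "\<dots> = (\<integral>\<^sup>+x. f (radial_proj n x) \<partial>?U)"
    by (rule nn_integral_distr) auto
  also have "\<dots> = (\<integral>\<^sup>+x. f (radial_proj n x) * indicator (unit_ball n) x \<partial>lebesgue_n n) / emeasure (lebesgue_n n) (unit_ball n)"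
    by (rule nn_integral_uniform_measure) auto
  finally show ?thesis by (simp add: emeasure_unit_ball)
qed

lemma nn_moment_std_normal:
  assumes "even m"
  shows "(\<integral>\<^sup>+u. ennreal (u ^ m) \<partial>std_normal_distribution) \<noteq> 0"
    and "(\<integral>\<^sup>+u. ennreal (u ^ m) \<partial>std_normal_distribution) \<noteq> \<infinity>"
proof -
  obtain k where k: "m = 2 * k" using assms by blast
  have "has_bochner_integral lborel (\<lambda>x. std_normal_density x * x ^ m) (fact (2 * k) / (2 ^ k * fact k))"
    unfolding k by (rule std_normal_moment_even)
  then have "(\<integral>\<^sup>+x. ennreal (std_normal_density x * x ^ m) \<partial>lborel) = ennreal (fact (2 * k) / (2 ^ k * fact k))"
    using assms by (intro nn_integral_eq_integral[THEN trans])
      (auto simp: has_bochner_integral_iff intro!: zero_le_even_power)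
  moreover have "(\<integral>\<^sup>+u. ennreal (u ^ m) \<partial>std_normal_distribution) = (\<integral>\<^sup>+x. ennreal (std_normal_density x * x ^ m) \<partial>lborel)"
    by (subst nn_integral_density) (auto simp: ennreal_mult'[OF normal_density_nonneg])
  ultimately have "(\<integral>\<^sup>+u. ennreal (u ^ m) \<partial>std_normal_distribution) = ennreal (fact (2 * k) / (2 ^ k * fact k))"
    by simp
  moreover have "(fact (2 * k) / (2 ^ k * fact k) :: real) > 0" by simp
  ultimately show "(\<integral>\<^sup>+u. ennreal (u ^ m) \<partial>std_normal_distribution) \<noteq> 0"
    and "(\<integral>\<^sup>+u. ennreal (u ^ m) \<partial>std_normal_distribution) \<noteq> \<infinity>"
    by (simp_all add: ennreal_eq_0_iff not_le del: divide_eq_0_iff)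
qed

lemma prod_std_normal_density:
  "(\<Prod>i<n. std_normal_density (x i)) = (1 / sqrt (2 * pi)) ^ n * exp (- (vnorm n x)\<^sup>2 / 2)"
proof -
  have "- (vnorm n x)\<^sup>2 / 2 = (\<Sum>i<n. - (x i)\<^sup>2 / 2)"
    by (simp add: vnorm_def sum_nonneg sum_divide_distrib sum_negf)
  then show ?thesis
    by (simp add: std_normal_density_def exp_sum prod_dividef power_divide)
qed

text \<open>Up to the ball volume, the Gaussian moment of \<open>vdot n v x\<close> is the spherical
  moment times a radial factor \<open>Z\<close> that does not involve \<open>v\<close>. Since the
  Gaussian moment scales as the m-th power of the norm of \<open>v\<close>, so does the spherical
  one.\<close>

lemma nn_moment_sphere:
  assumes n: "n \<ge> 1" and m: "even m" and e: "vnorm n e = 1"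
  shows "(\<integral>\<^sup>+z. ennreal ((vdot n v z) ^ m) \<partial>sphere_measure n)
    = ennreal (vnorm n v ^ m) * (\<integral>\<^sup>+z. ennreal ((vdot n e z) ^ m) \<partial>sphere_measure n)"
proof -
  let ?L = "lebesgue_n n" and ?N = "std_normal_distribution"
  define h where "h v x = ennreal (vdot n v (radial_proj n x) ^ m)" for v x
  define c where "c v = (\<integral>\<^sup>+x. h v x * indicator (unit_ball n) x \<partial>?L)" for v
  \<comment> \<open>The radial part of the integrand: r^m is split off from the m-th power of the
    linear form, and the rest is the Gaussian density at radius r.\<close>
  define \<psi> where "\<psi> r = r ^ m * ((1 / sqrt (2 * pi)) ^ n * exp (- r\<^sup>2 / 2))" for r :: real
  define Z where "Z = (\<integral>\<^sup>+x. ennreal (\<psi> (vnorm n x)) \<partial>?L)"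
  define a where "a = ennreal (unit_ball_vol (real n))"
  define g where "g = (\<integral>\<^sup>+u. ennreal (u ^ m) \<partial>?N)"
  have h_meas [measurable]: "h v \<in> borel_measurable ?L" for v
    unfolding h_def by measurable
  have \<psi>_meas [measurable]: "\<psi> \<in> borel_measurable borel"
    unfolding \<psi>_def by measurable
  have a: "a \<noteq> 0" "a \<noteq> \<infinity>"
    using less_imp_neq[OF unit_ball_vol_pos[of "real n"]] by (simp_all add: a_def)
  have g: "g \<noteq> 0" "g \<noteq> \<infinity>"
    unfolding g_def using nn_moment_std_normal[OF m] .
  have fin: "c v < \<infinity>" for v
  proof -
    have "h v x \<le> ennreal ((\<Sum>i<n. \<bar>v i\<bar>) ^ m)" for x
      unfolding h_def using abs_vdot_radial_proj_le[of n v x] m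
      by (intro ennreal_leI) (metis power_even_abs power_mono abs_ge_zero)
    then have "c v \<le> (\<integral>\<^sup>+x. ennreal ((\<Sum>i<n. \<bar>v i\<bar>) ^ m) * indicator (unit_ball n) x \<partial>?L)"
      unfolding c_def by (intro nn_integral_mono mult_right_mono) auto
    also have "\<dots> < \<infinity>"
      by (simp add: nn_integral_cmult_indicator emeasure_unit_ball ennreal_mult_less_top)
    finally show ?thesis .
  qed
  have gauss: "(\<integral>\<^sup>+x. h v x * ennreal (\<psi> (vnorm n x)) \<partial>?L) = ennreal (vnorm n v ^ m) * g" for v
  proof -
    have "(\<integral>\<^sup>+x. h v x * ennreal (\<psi> (vnorm n x)) \<partial>?L)
      = (\<integral>\<^sup>+x. ennreal (\<Prod>i<n. std_normal_density (x i)) * ennreal (vdot n v x ^ m) \<partial>?L)"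
    proof (rule nn_integral_cong_AE, rule AE_mp[OF AE_vnorm_nonzero[OF n]], rule AE_I2, rule impI)
      fix x assume "vnorm n x \<noteq> 0"
      then have "vdot n v x ^ m = vdot n v (radial_proj n x) ^ m * vnorm n x ^ m"
        by (simp add: vdot_radial_proj power_divide)
      then show "h v x * ennreal (\<psi> (vnorm n x)) = ennreal (\<Prod>i<n. std_normal_density (x i)) * ennreal (vdot n v x ^ m)"
        unfolding h_def \<psi>_def prod_std_normal_density
        using m by (simp add: ennreal_mult'[symmetric] zero_le_even_power vnorm_nonneg mult_ac)
    qed
    also have "\<dots> = (\<integral>\<^sup>+x. ennreal (vdot n v x ^ m) \<partial>(\<Pi>\<^sub>M i\<in>{..<n}. ?N))"
      unfolding PiM_std_normal by (subst nn_integral_density) auto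
    also have "\<dots> = (\<integral>\<^sup>+u. ennreal (u ^ m) \<partial>distr (\<Pi>\<^sub>M i\<in>{..<n}. ?N) borel (vdot n v))"
      by (subst nn_integral_distr) (auto simp: PiM_std_normal)
    also have "\<dots> = (\<integral>\<^sup>+u. ennreal (vnorm n v ^ m) * ennreal (u ^ m) \<partial>?N)"
      unfolding distr_vdot_std_normal
      by (subst nn_integral_distr) (auto simp: power_mult_distrib ennreal_mult' vnorm_nonneg)
    finally show ?thesis by (simp add: nn_integral_cmult g_def)
  qed
  have polar: "a * (ennreal (vnorm n v ^ m) * g) = c v * Z" for v
    unfolding gauss[symmetric] a_def c_def Z_def
  proof (rule nn_integral_scale_invariant[OF n])
    show "h v (\<lambda>i\<in>{..<n}. r * x i) = h v x" if "r > 0" for r x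
      using that by (simp add: h_def vdot_radial_proj vdot_scale vnorm_scale)
    show "(\<integral>\<^sup>+x. h v x * indicator (unit_ball n) x \<partial>?L) < \<infinity>"
      using fin[of v] by (simp add: c_def)
  qed auto
  \<comment> \<open>The case v = e shows that \<open>Z\<close> is neither 0 nor infinite, which
    permits cancelling it for general v.\<close>
  have "c e * Z = a * g" using polar[of e] e by simp
  moreover have "a * g \<noteq> 0" "a * g \<noteq> \<infinity>"
    using a g by (auto simp: ennreal_mult_eq_top_iff)
  ultimately have "Z \<noteq> 0" "Z \<noteq> \<infinity>"
    by (metis mult_zero_right, metis ennreal_mult_top mult_zero_left infinity_ennreal_def)
  moreover have "Z * c v = Z * (ennreal (vnorm n v ^ m) * c e)"
  proof -
    have "Z * c v = ennreal (vnorm n v ^ m) * (a * g)"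
      using polar[of v] by (simp add: mult_ac)
    also have "a * g = c e * Z" using polar[of e] e by simp
    finally show ?thesis by (simp add: mult_ac)
  qed
  ultimately have "c v = ennreal (vnorm n v ^ m) * c e"
    by (simp add: ennreal_mult_cancel_left)
  moreover have "(\<integral>\<^sup>+z. ennreal ((vdot n w z) ^ m) \<partial>sphere_measure n) = c w / a" for w
    unfolding c_def a_def h_def by (rule nn_integral_sphere[OF n]) simp
  ultimately show ?thesis by (simp add: ennreal_times_divide)
qed

text \<open>The antipodal map is scaling by -1, which preserves Lebesgue measure and the ball and
  commutes with the radial projection.\<close>

lemma nn_integral_sphere_uminus:
  assumes n: "n \<ge> 1" and [measurable]: "f \<in> borel_measurable borel"
  shows "(\<integral>\<^sup>+z. f (- vdot n v z) \<partial>sphere_measure n) = (\<integral>\<^sup>+z. f (vdot n v z) \<partial>sphere_measure n)"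
proof -
  have "(\<integral>\<^sup>+x. f (vdot n v (radial_proj n x)) * indicator (unit_ball n) x \<partial>lebesgue_n n)
    = (\<integral>\<^sup>+x. f (- vdot n v (radial_proj n x)) * indicator (unit_ball n) x \<partial>lebesgue_n n)"
    by (subst nn_integral_lebesgue_n_scale[of "-1"])
      (auto simp: vdot_radial_proj vdot_scale[of n v "-1", simplified] vnorm_scale[of n "-1", simplified]
        unit_ball_def space_PiM intro!: nn_integral_cong split: split_indicator)
  then show ?thesis by (simp add: nn_integral_sphere[OF n])
qed

lemma vnorm_sq: "(vnorm n x)\<^sup>2 = vdot n x x"
  by (simp add: vnorm_def vdot_def sum_nonneg power2_eq_square)

lemma vdot_commute: "vdot n x y = vdot n y x"
  by (simp add: vdot_def mult.commute)

lemma vdot_self: "x \<in> unit_sphere n \<Longrightarrow> vdot n x x = 1"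
  using vnorm_sq[of n x] by (simp add: unit_sphere_def)

lemma abs_vdot_le_1:
  assumes "x \<in> unit_sphere n" "y \<in> unit_sphere n"
  shows "\<bar>vdot n x y\<bar> \<le> 1"
proof -
  have "\<bar>vdot n x y\<bar> \<le> (\<Sum>i<n. \<bar>x i\<bar> * \<bar>y i\<bar>)"
    unfolding vdot_def by (intro order_trans[OF sum_abs]) (simp add: abs_mult)
  also have "\<dots> \<le> vnorm n x * vnorm n y"
    using L2_set_mult_ineq[of x y "{..<n}"] by (simp add: vnorm_def L2_set_def)
  finally show ?thesis using assms by (simp add: unit_sphere_def)
qed

lemma vdot_in_Icc:
  "x \<in> unit_sphere n \<Longrightarrow> y \<in> unit_sphere n \<Longrightarrow> vdot n x y \<in> {-1..1}"
  using abs_vdot_le_1[of x n y] by auto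

text \<open>For unit vectors x, y with inner product w, the squared norm of x + T y is 1 + 2 w T +
  T^2. The coefficients of its l-th power are needed as polynomials in w; each recursion step
  multiplies by one more factor.\<close>

primrec trinomial :: "nat \<Rightarrow> nat \<Rightarrow> real poly" where
  "trinomial 0 = (\<lambda>b. if b = 0 then 1 else 0)"
| "trinomial (Suc l) = (\<lambda>b. trinomial l b
    + (if b \<ge> 1 then [:0, 2:] * trinomial l (b - 1) else 0)
    + (if b \<ge> 2 then trinomial l (b - 2) else 0))"

lemma coeff_trinomial: "coeff ([:1, 2 * w, 1:] ^ l) b = poly (trinomial l b) w"
proof (induction l arbitrary: b)
  case 0
  show ?case by (simp add: coeff_1)
next
  case (Suc l)
  have "coeff ([:1, 2 * w, 1:] * q) b = coeff q b + (if b \<ge> 1 then 2 * w * coeff q (b - 1) else 0)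
    + (if b \<ge> 2 then coeff q (b - 2) else 0)" for q :: "real poly"
    by (auto simp: coeff_pCons split: nat.splits)
  then show ?case by (simp add: Suc.IH)
qed

lemma degree_trinomial: "degree (trinomial l b) \<le> b"
proof (induction l arbitrary: b)
  case (Suc l)
  have "degree ([:0, 2:] * trinomial l (b - 1)) \<le> b" if "b \<ge> 1"
    using degree_mult_le[of "[:0, 2:]" "trinomial l (b - 1)"] Suc[of "b - 1"] that by simp
  moreover have "degree (trinomial l (b - 2)) \<le> b"
    using Suc[of "b - 2"] by simp
  ultimately show ?case using Suc[of b]
    by (auto intro!: degree_add_le simp del: mult_pCons_left)
qed auto

lemma trinomial_0_2: "trinomial l 0 = 1" "poly (trinomial l 2) 0 = real l"
  by (induction l) auto

locale sphere =
  fixes n :: nat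
  assumes n2: "n \<ge> 2"
begin

abbreviation "\<mu> \<equiv> sphere_measure n"
abbreviation "S \<equiv> unit_sphere n"
abbreviation "dot \<equiv> vdot n"

sublocale prob_space \<mu>
  using n2 by (intro prob_space_sphere_measure) simp

definition basis :: "nat \<Rightarrow> nat \<Rightarrow> real" where
  "basis i = (\<lambda>j\<in>{..<n}. if j = i then 1 else 0)"

lemma dot_basis: "i < n \<Longrightarrow> dot (basis i) z = z i"
  by (simp add: vdot_def basis_def if_distrib[of "\<lambda>a. a * _"] cong: if_cong)

lemma basis_in_S: "i < n \<Longrightarrow> basis i \<in> S"
  by (simp add: unit_sphere_def vnorm_def basis_def space_PiM if_distrib[of "\<lambda>a. a ^ _"] cong: if_cong)

lemma space_\<mu>: "space \<mu> = S"
  by (rule space_sphere_measure)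

lemma measurable_\<mu>: "f \<in> borel_measurable (lebesgue_n n) \<Longrightarrow> f \<in> borel_measurable \<mu>"
  unfolding sphere_measure_def by (intro measurable_restrict_space1) simp

lemma component_measurable_\<mu> [measurable]: "i < n \<Longrightarrow> (\<lambda>x. x i) \<in> borel_measurable \<mu>"
  by (intro measurable_\<mu>) measurable

lemma dot_measurable_pair [measurable]:
  assumes [measurable]: "f \<in> measurable M \<mu>" "g \<in> measurable M \<mu>"
  shows "(\<lambda>p. dot (f p) (g p)) \<in> borel_measurable M"
  unfolding vdot_def
proof (rule borel_measurable_sum)
  fix i assume "i \<in> {..<n}"
  then have [measurable]: "(\<lambda>x. x i) \<in> borel_measurable \<mu>" by simp
  show "(\<lambda>p. f p i * g p i) \<in> borel_measurable M" by measurable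
qed

lemma dot_measurable [measurable]: "dot v \<in> borel_measurable \<mu>"
  by (intro measurable_\<mu>) simp

lemma continuous_bounded:
  fixes f :: "real \<Rightarrow> real"
  assumes "continuous_on UNIV f"
  shows "\<exists>B>0. \<forall>u\<in>{-1..1}. \<bar>f u\<bar> \<le> B"
proof -
  have "compact (f ` {-1..1})"
    using assms by (intro compact_continuous_image continuous_on_subset[OF assms]) auto
  then obtain B where "\<forall>v\<in>f ` {-1..1}. norm v \<le> B"
    using compact_imp_bounded bounded_iff by metis
  then show ?thesis by (intro exI[of _ "max B 1"]) force
qed

lemma continuous_measurable:
  fixes f :: "real \<Rightarrow> real"
  shows "continuous_on UNIV f \<Longrightarrow> f \<in> borel_measurable borel"
  by (rule borel_measurable_continuous_onI)

lemma integrable_bounded: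
  assumes "f \<in> borel_measurable \<mu>" "\<And>z. z \<in> S \<Longrightarrow> \<bar>f z\<bar> \<le> (B :: real)"
  shows "integrable \<mu> f"
  using assms by (intro integrable_const_bound[of _ B]) (auto simp: space_\<mu>)

lemma integrable_dot:
  fixes f :: "real \<Rightarrow> real"
  assumes "continuous_on UNIV f" "x \<in> S"
  shows "integrable \<mu> (\<lambda>z. f (dot x z))"
proof -
  obtain B where B: "\<forall>u\<in>{-1..1}. \<bar>f u\<bar> \<le> B"
    using continuous_bounded[OF assms(1)] by blast
  have [measurable]: "f \<in> borel_measurable borel"
    using assms by (intro continuous_measurable)
  show ?thesis
    using assms(2) by (intro integrable_bounded[of _ B] bspec[OF B] vdot_in_Icc) auto
qed

text \<open>The mean of a zonal function. The pole \<open>basis 0\<close> is an arbitrary choice, as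
  \<open>E_invariant\<close> shows.\<close>

definition E :: "(real \<Rightarrow> real) \<Rightarrow> real" where
  "E f = (\<integral>z. f (dot (basis 0) z) \<partial>\<mu>)"

definition \<kappa> :: "nat \<Rightarrow> real" where
  "\<kappa> m = E (\<lambda>u. u ^ m)"

lemma integrable_power_dot: "integrable \<mu> (\<lambda>z. dot v z ^ m)"
proof (rule integrable_bounded)
  fix z assume "z \<in> S"
  then have "radial_proj n z = z"
    by (auto simp: unit_sphere_def radial_proj_def space_PiM PiE_iff extensional_def)
  then have "\<bar>dot v z\<bar> \<le> (\<Sum>i<n. \<bar>v i\<bar>)"
    using abs_vdot_radial_proj_le[of n v z] by simp
  then show "\<bar>dot v z ^ m\<bar> \<le> (\<Sum>i<n. \<bar>v i\<bar>) ^ m"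
    by (simp add: power_abs power_mono)
qed simp

lemma moment:
  "(\<integral>z. dot v z ^ m \<partial>\<mu>) = (if even m then vnorm n v ^ m * \<kappa> m else 0)"
proof (cases "even m")
  case True
  have *: "(\<integral>z. dot v z ^ m \<partial>\<mu>) = enn2real (\<integral>\<^sup>+z. ennreal (dot v z ^ m) \<partial>\<mu>)" for v
    using True by (intro integral_eq_nn_integral) (auto simp: zero_le_even_power)
  have "vnorm n (basis 0) = 1"
    using basis_in_S[of 0] n2 by (simp add: unit_sphere_def)
  then show ?thesis
    using nn_moment_sphere[of n m "basis 0" v] n2 True
    by (simp add: * \<kappa>_def E_def enn2real_mult vnorm_nonneg)
next
  case False
  then have "(- dot v z) ^ m = - (dot v z ^ m)" for z by simp
  then have "(\<integral>\<^sup>+z. ennreal (- (dot v z ^ m)) \<partial>\<mu>) = (\<integral>\<^sup>+z. ennreal (dot v z ^ m) \<partial>\<mu>)"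
    using nn_integral_sphere_uminus[of n "\<lambda>u. ennreal (u ^ m)" v] n2 by simp
  then show ?thesis
    using False by (simp add: real_lebesgue_integral_def[OF integrable_power_dot])
qed

text \<open>The coefficient of T^b in the (a + b)-th moment of x + T y, freed of the binomial
  coefficient that comes from expanding the power.\<close>

definition pair_moment_poly :: "nat \<Rightarrow> nat \<Rightarrow> real poly" where
  "pair_moment_poly a b = (if even (a + b)
     then smult (\<kappa> (a + b) / real ((a + b) choose b)) (trinomial ((a + b) div 2) b) else 0)"

text \<open>A bound by the second exponent alone; it becomes the degree bound in
  \<open>convolution_poly\<close>.\<close>

lemma degree_pair_moment_poly: "degree (pair_moment_poly a b) \<le> b"
  using degree_trinomial[of "(a + b) div 2" b] degree_smult_le order_trans
  by (auto simp: pair_moment_poly_def)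

lemma integrable_power_dot2:
  assumes "x \<in> S" "y \<in> S"
  shows "integrable \<mu> (\<lambda>z. dot x z ^ a * dot y z ^ b)"
proof (rule integrable_bounded)
  fix z assume "z \<in> S"
  then have "\<bar>dot x z\<bar> ^ a * \<bar>dot y z\<bar> ^ b \<le> 1 * 1"
    using assms by (intro mult_mono power_le_one abs_vdot_le_1) auto
  then show "\<bar>dot x z ^ a * dot y z ^ b\<bar> \<le> 1"
    by (simp add: abs_mult power_abs)
qed simp

text \<open>Polarization: both sides of the moment formula for \<open>x + \<beta> y\<close> are polynomials in \<open>\<beta>\<close>.\<close>

lemma pair_moment:
  assumes "x \<in> S" "y \<in> S"
  shows "(\<integral>z. dot x z ^ a * dot y z ^ b \<partial>\<mu>) = poly (pair_moment_poly a b) (dot x y)"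
proof -
  define m where "m = a + b"
  define J where "J k = (\<integral>z. dot x z ^ (m - k) * dot y z ^ k \<partial>\<mu>)" for k
  define w where "w = dot x y"
  have vn: "vnorm n (\<lambda>i. x i + \<beta> * y i) ^ m = poly ([:1, 2 * w, 1:] ^ (m div 2)) \<beta>" if "even m" for \<beta>
  proof -
    have "(vnorm n (\<lambda>i. x i + \<beta> * y i))\<^sup>2 = dot x x + 2 * \<beta> * dot x y + \<beta>\<^sup>2 * dot y y"
      unfolding vnorm_sq
      by (simp add: vdot_def sum.distrib[symmetric] sum_distrib_left power2_eq_square algebra_simps)
    also have "\<dots> = poly [:1, 2 * w, 1:] \<beta>"
      using assms by (simp add: vdot_self w_def power2_eq_square algebra_simps)
    finally have sq: "(vnorm n (\<lambda>i. x i + \<beta> * y i))\<^sup>2 = poly [:1, 2 * w, 1:] \<beta>" .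
    have "vnorm n (\<lambda>i. x i + \<beta> * y i) ^ m = ((vnorm n (\<lambda>i. x i + \<beta> * y i))\<^sup>2) ^ (m div 2)"
      using that by (simp add: power_mult[symmetric])
    then show ?thesis unfolding sq poly_power .
  qed
  have "poly (\<Sum>k\<le>m. monom (real (m choose k) * J k) k) \<beta>
      = poly (if even m then smult (\<kappa> m) ([:1, 2 * w, 1:] ^ (m div 2)) else 0) \<beta>" for \<beta>
  proof -
    have "poly (\<Sum>k\<le>m. monom (real (m choose k) * J k) k) \<beta>
      = (\<Sum>k\<le>m. \<integral>z. real (m choose k) * \<beta> ^ k * (dot x z ^ (m - k) * dot y z ^ k) \<partial>\<mu>)"
      by (simp add: poly_sum poly_monom J_def mult_ac)
    also have "\<dots> = (\<integral>z. (\<Sum>k\<le>m. real (m choose k) * \<beta> ^ k * (dot x z ^ (m - k) * dot y z ^ k)) \<partial>\<mu>)"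
      using assms by (subst Bochner_Integration.integral_sum) (auto intro!: integrable_power_dot2)
    also have "\<dots> = (\<integral>z. (dot (\<lambda>i. x i + \<beta> * y i) z) ^ m \<partial>\<mu>)"
    proof (rule Bochner_Integration.integral_cong[OF refl])
      fix z
      have "dot (\<lambda>i. x i + \<beta> * y i) z = \<beta> * dot y z + dot x z"
        by (simp add: vdot_def sum.distrib sum_distrib_left algebra_simps)
      then show "(\<Sum>k\<le>m. real (m choose k) * \<beta> ^ k * (dot x z ^ (m - k) * dot y z ^ k))
          = (dot (\<lambda>i. x i + \<beta> * y i) z) ^ m"
        by (simp add: binomial_ring power_mult_distrib mult_ac)
    qed
    also have "\<dots> = poly (if even m then smult (\<kappa> m) ([:1, 2 * w, 1:] ^ (m div 2)) else 0) \<beta>"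
      unfolding moment using vn[of \<beta>] by simp
    finally show ?thesis .
  qed
  then have "(\<Sum>k\<le>m. monom (real (m choose k) * J k) k)
      = (if even m then smult (\<kappa> m) ([:1, 2 * w, 1:] ^ (m div 2)) else 0)"
    by (intro poly_eq_poly_eq_iff[THEN iffD1] ext)
  from arg_cong[OF this, of "\<lambda>p. coeff p b"]
  have "real (m choose b) * J b = (if even m then \<kappa> m * poly (trinomial (m div 2) b) w else 0)"
    by (simp add: coeff_sum coeff_trinomial m_def split: if_splits)
  moreover have "m choose b > 0" by (simp add: m_def)
  ultimately have "J b = (if even m then \<kappa> m * poly (trinomial (m div 2) b) w / real (m choose b) else 0)"
    by (auto simp: field_simps)
  then show ?thesis
    by (simp add: J_def pair_moment_poly_def m_def w_def)
qed

lemma \<kappa>_odd: "odd m \<Longrightarrow> \<kappa> m = 0"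
  using moment[of "basis 0" m] by (simp add: \<kappa>_def E_def)

text \<open>Insert sum z_i^2 = 1 into the m-th moment of z_0. The term i = 0 is
  \<open>\<kappa> (m + 2)\<close>, and each of the other n - 1 terms is a pair moment of orthogonal
  vectors.\<close>

lemma \<kappa>_rec: "(real m + real n) * \<kappa> (m + 2) = (real m + 1) * \<kappa> m"
proof (cases "even m")
  case False
  then show ?thesis by (simp add: \<kappa>_odd)
next
  case True
  then obtain l where l: "m = 2 * l" by blast
  have 0: "basis 0 \<in> S" using basis_in_S[of 0] n2 by simp
  have other: "(\<integral>z. dot (basis 0) z ^ m * dot (basis i) z ^ 2 \<partial>\<mu>) = \<kappa> (m + 2) / (real m + 1)" if i: "i < n" "i \<noteq> 0" for i
  proof -
    have "dot (basis 0) (basis i) = 0"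
      using i n2 by (subst dot_basis) (auto simp: basis_def)
    \<comment> \<open>The factor l + 1 here cancels against the trinomial coefficient at w = 0,
      leaving 1 / (m + 1).\<close>
    moreover have "real ((m + 2) choose 2) = (real l + 1) * (real m + 1)"
      by (simp add: choose_two l algebra_simps)
    moreover have "poly (trinomial ((m + 2) div 2) 2) 0 = real l + 1"
      using trinomial_0_2(2)[of "l + 1"] by (simp add: l)
    ultimately show ?thesis
      using pair_moment[OF 0 basis_in_S[OF i(1)], of m 2] True
      by (simp add: pair_moment_poly_def del: choose_two)
  qed
  have "\<kappa> m = (\<integral>z. (\<Sum>i<n. dot (basis 0) z ^ m * dot (basis i) z ^ 2) \<partial>\<mu>)"
    unfolding \<kappa>_def E_def
  proof (rule Bochner_Integration.integral_cong[OF refl])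
    fix z assume "z \<in> space \<mu>"
    then have "(\<Sum>i<n. dot (basis i) z ^ 2) = 1"
      using vdot_self[of z n] by (simp add: space_\<mu> dot_basis power2_eq_square vdot_def[of n z z])
    then show "dot (basis 0) z ^ m = (\<Sum>i<n. dot (basis 0) z ^ m * dot (basis i) z ^ 2)"
      by (simp add: sum_distrib_left[symmetric])
  qed
  also have "\<dots> = (\<Sum>i<n. \<integral>z. dot (basis 0) z ^ m * dot (basis i) z ^ 2 \<partial>\<mu>)"
    using 0 basis_in_S by (intro Bochner_Integration.integral_sum integrable_power_dot2) auto
  also have "\<dots> = (\<Sum>i<n. if i = 0 then \<kappa> (m + 2) else \<kappa> (m + 2) / (real m + 1))"
    using other by (intro sum.cong) (auto simp: \<kappa>_def E_def power_add[symmetric])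
  also have "{..<n} = insert 0 {1..<n}" using n2 by auto
  also have "(\<Sum>i\<in>insert 0 {1..<n}. if i = 0 then \<kappa> (m + 2) else \<kappa> (m + 2) / (real m + 1))
      = \<kappa> (m + 2) + (real n - 1) * (\<kappa> (m + 2) / (real m + 1))"
    using n2 by (simp add: of_nat_diff)
  finally show ?thesis by (simp add: field_simps)
qed

lemma \<kappa>_0 [simp]: "\<kappa> 0 = 1"
  by (simp add: \<kappa>_def E_def prob_space)

lemma \<kappa>_even_pos: "\<kappa> (2 * m) > 0"
proof (induction m)
  case (Suc m)
  have "(real (2 * m) + real n) * \<kappa> (2 * m + 2) > 0"
    unfolding \<kappa>_rec using Suc by simp
  then show ?case using n2 by (simp add: zero_less_mult_iff)
qed simp

end

section \<open>Zonal convolution\<close>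

lemma polynomial_approximation:
  fixes f :: "real \<Rightarrow> real"
  assumes "continuous_on UNIV f" "\<epsilon> > 0"
  shows "\<exists>p. \<forall>u\<in>{-1..1}. \<bar>f u - poly p u\<bar> < \<epsilon>"
proof -
  have "continuous_on {-1..1} f"
    using assms(1) by (rule continuous_on_subset) simp
  then have "\<exists>g. real_polynomial_function g \<and> (\<forall>u\<in>{-1..1}. \<bar>f u - g u\<bar> < \<epsilon>)"
    by (rule Stone_Weierstrass_real_polynomial_function[OF compact_Icc _ assms(2)])
      (intro exI conjI ballI; assumption?; simp)
  then obtain g where g: "real_polynomial_function g" "\<forall>u\<in>{-1..1}. \<bar>f u - g u\<bar> < \<epsilon>"
    by blast
  from real_polynomial_function_imp_sum[OF g(1)]
  obtain a N where "g = (\<lambda>u. \<Sum>i\<le>N. a i * u ^ i)" by (elim exE)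
  then have "g u = poly (\<Sum>i\<le>N. monom (a i) i) u" for u
    by (simp add: poly_sum poly_monom)
  then show ?thesis using g(2) by (intro exI[of _ "\<Sum>i\<le>N. monom (a i) i"]) simp
qed

lemma continuous_on_poly' [continuous_intros]: "continuous_on A (poly (p :: real poly))"
  by (intro continuous_on_poly continuous_on_id)

context sphere
begin

text \<open>Transfers identities from polynomials to continuous functions: \<open>C\<close> is
  independent of \<epsilon> and p, so letting \<epsilon> tend to 0 forces equality.\<close>

lemma approx_eqI:
  fixes f :: "real \<Rightarrow> real"
  assumes "continuous_on UNIV f"
    and "\<And>\<epsilon> p. \<epsilon> > 0 \<Longrightarrow> (\<forall>u\<in>{-1..1}. \<bar>f u - poly p u\<bar> \<le> \<epsilon>) \<Longrightarrow> \<bar>a - b\<bar> \<le> C * \<epsilon>"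
  shows "a = b"
proof -
  have bound: "\<bar>a - b\<bar> \<le> C * \<epsilon>" if \<epsilon>: "\<epsilon> > 0" for \<epsilon>
  proof -
    obtain p where "\<forall>u\<in>{-1..1}. \<bar>f u - poly p u\<bar> < \<epsilon>"
      using polynomial_approximation[OF assms(1) \<epsilon>] by blast
    then have "\<forall>u\<in>{-1..1}. \<bar>f u - poly p u\<bar> \<le> \<epsilon>" by (auto intro: less_imp_le)
    then show ?thesis by (rule assms(2)[OF \<epsilon>])
  qed
  have "((\<lambda>\<epsilon>. C * \<epsilon>) \<longlongrightarrow> C * 0) (at_right 0)"
    by (intro tendsto_intros)
  moreover have "eventually (\<lambda>\<epsilon>. \<bar>a - b\<bar> \<le> C * \<epsilon>) (at_right 0)"
    by (rule eventually_mono[OF eventually_at_right_less bound])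
  ultimately have "\<bar>a - b\<bar> \<le> C * 0"
    by (rule tendsto_lowerbound) simp
  then show ?thesis by simp
qed

lemma integral_close:
  fixes f g :: "(nat \<Rightarrow> real) \<Rightarrow> real"
  assumes "integrable \<mu> f" "integrable \<mu> g" "\<And>z. z \<in> S \<Longrightarrow> \<bar>f z - g z\<bar> \<le> \<epsilon>"
  shows "\<bar>(\<integral>z. f z \<partial>\<mu>) - (\<integral>z. g z \<partial>\<mu>)\<bar> \<le> \<epsilon>"
proof -
  have "\<bar>\<integral>z. f z - g z \<partial>\<mu>\<bar> \<le> (\<integral>z. \<bar>f z - g z\<bar> \<partial>\<mu>)"
    by (rule integral_abs_bound)
  also have "\<dots> \<le> (\<integral>z. \<epsilon> \<partial>\<mu>)"
    using assms by (intro integral_mono) (auto simp: space_\<mu>)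
  finally show ?thesis using assms by (simp add: prob_space)
qed

lemma integrable_dot2:
  fixes f g :: "real \<Rightarrow> real"
  assumes f: "continuous_on UNIV f" and g: "continuous_on UNIV g" and x: "x \<in> S" and y: "y \<in> S"
  shows "integrable \<mu> (\<lambda>z. f (dot x z) * g (dot y z))"
proof -
  obtain B where B: "\<forall>u\<in>{-1..1}. \<bar>f u\<bar> \<le> B" "B > 0"
    using continuous_bounded[OF f] by blast
  obtain C where C: "\<forall>u\<in>{-1..1}. \<bar>g u\<bar> \<le> C" "C > 0"
    using continuous_bounded[OF g] by blast
  have [measurable]: "f \<in> borel_measurable borel" "g \<in> borel_measurable borel"
    using f g by (auto intro: continuous_measurable)
  have "\<bar>f (dot x z) * g (dot y z)\<bar> \<le> B * C" if "z \<in> S" for z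
    unfolding abs_mult using B C x y that by (intro mult_mono bspec[OF B(1)] bspec[OF C(1)] vdot_in_Icc) auto
  then show ?thesis by (intro integrable_bounded[of _ "B * C"]) auto
qed

lemma basis0_in_S: "basis 0 \<in> S"
  using basis_in_S n2 by simp

lemma integrable_E: "continuous_on UNIV (f :: real \<Rightarrow> real) \<Longrightarrow> integrable \<mu> (\<lambda>z. f (dot (basis 0) z))"
  by (rule integrable_dot[where f = f, OF _ basis0_in_S])

lemma E_add: "continuous_on UNIV f \<Longrightarrow> continuous_on UNIV g \<Longrightarrow> E (\<lambda>u. f u + g u) = E f + E g"
  unfolding E_def by (intro Bochner_Integration.integral_add integrable_E)

lemma E_cmult: "E (\<lambda>u. c * f u) = c * E f"
  unfolding E_def by simp

lemma integral_poly_dot: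
  assumes "x \<in> S"
  shows "(\<integral>z. poly p (dot x z) \<partial>\<mu>) = (\<Sum>i\<le>degree p. coeff p i * \<kappa> i)"
proof -
  have "vnorm n x = 1" using assms by (simp add: unit_sphere_def)
  then have "(\<integral>z. dot x z ^ i \<partial>\<mu>) = \<kappa> i" for i
    using moment[of x i] by (simp add: \<kappa>_odd)
  then show ?thesis
    unfolding poly_altdef
    by (subst Bochner_Integration.integral_sum) (auto intro: integrable_power_dot)
qed

lemma E_poly: "x \<in> S \<Longrightarrow> (\<integral>z. poly p (dot x z) \<partial>\<mu>) = E (poly p)"
  unfolding E_def by (simp add: integral_poly_dot basis0_in_S)

lemma E_invariant:
  assumes f: "continuous_on UNIV f" and x: "x \<in> S"
  shows "(\<integral>z. f (dot x z) \<partial>\<mu>) = E f"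
proof (rule approx_eqI[OF f, where C = 2])
  fix \<epsilon> :: real and p
  assume *: "\<forall>u\<in>{-1..1}. \<bar>f u - poly p u\<bar> \<le> \<epsilon>"
  have "\<bar>(\<integral>z. f (dot x z) \<partial>\<mu>) - (\<integral>z. poly p (dot x z) \<partial>\<mu>)\<bar> \<le> \<epsilon>" if "x \<in> S" for x
    using that by (intro integral_close integrable_dot f continuous_on_poly' bspec[OF *] vdot_in_Icc) auto
  from this[OF x] this[OF basis0_in_S]
  show "\<bar>(\<integral>z. f (dot x z) \<partial>\<mu>) - E f\<bar> \<le> 2 * \<epsilon>"
    using x by (simp add: E_poly basis0_in_S E_def[of f])
qed

text \<open>\<open>\<kappa>_rec\<close> is the moment recursion with d = n - 2, so all the algebraic
  orthogonality results now hold for zonal means.\<close>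

sublocale ultra_functional "real n - 2" "\<lambda>p. E (poly p)"
proof
  show "real n - 2 \<ge> 0" using n2 by simp
  show "E (poly (p + q)) = E (poly p) + E (poly q)" for p q
    using E_add[of "poly p" "poly q"] by (simp add: continuous_on_poly' poly_add[abs_def])
  show "E (poly (smult c p)) = c * E (poly p)" for c p
    using E_cmult[of c "poly p"] by (simp add: poly_smult[abs_def])
  have monom: "E (poly (monom 1 m)) = \<kappa> m" for m
    by (simp add: \<kappa>_def poly_monom[abs_def])
  show "E (poly 1) = 1" using monom[of 0] by simp
  show "E (poly [:0, 1:]) = 0" using monom[of 1] \<kappa>_odd[of 1] by (simp add: monom_altdef)
  show "(real m + 2 + (real n - 2)) * E (poly (monom 1 (m + 2))) = (real m + 1) * E (poly (monom 1 m))" for m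
    unfolding monom using \<kappa>_rec[of m] by simp
qed

lemma convolution_poly:
  "\<exists>h. degree h \<le> degree q
    \<and> (\<forall>x\<in>S. \<forall>y\<in>S. (\<integral>z. poly p (dot x z) * poly q (dot y z) \<partial>\<mu>) = poly h (dot x y))"
proof (intro exI conjI ballI)
  let ?h = "\<Sum>a\<le>degree p. \<Sum>b\<le>degree q. smult (coeff p a * coeff q b) (pair_moment_poly a b)"
  show "degree ?h \<le> degree q"
    by (intro degree_sum_le degree_smult_le[THEN order_trans] degree_pair_moment_poly[THEN order_trans]) auto
  fix x y assume xy: "x \<in> S" "y \<in> S"
  have "(\<integral>z. poly p (dot x z) * poly q (dot y z) \<partial>\<mu>)
    = (\<integral>z. (\<Sum>a\<le>degree p. \<Sum>b\<le>degree q. (coeff p a * coeff q b) * (dot x z ^ a * dot y z ^ b)) \<partial>\<mu>)"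
    by (simp add: poly_altdef sum_product mult_ac)
  also have "\<dots> = (\<Sum>a\<le>degree p. \<Sum>b\<le>degree q. (coeff p a * coeff q b) * (\<integral>z. dot x z ^ a * dot y z ^ b \<partial>\<mu>))"
    using xy by (simp add: Bochner_Integration.integral_sum Bochner_Integration.integrable_sum integrable_power_dot2)
  also have "\<dots> = poly ?h (dot x y)"
    by (simp add: poly_sum pair_moment[OF xy])
  finally show "(\<integral>z. poly p (dot x z) * poly q (dot y z) \<partial>\<mu>) = poly ?h (dot x y)" .
qed

text \<open>By Fubini, pairing the convolution of p and \<open>P j\<close> with \<open>q\<close>
  equals pairing \<open>P j\<close> with the convolution of p and q. The latter has degree at most
  that of q, below j, hence is orthogonal to \<open>P j\<close>.\<close>

lemma convolution_lower:
  assumes h: "\<And>x y. x \<in> S \<Longrightarrow> y \<in> S \<Longrightarrow> (\<integral>z. poly p (dot x z) * poly (P j) (dot y z) \<partial>\<mu>) = poly h (dot x y)"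
    and q: "degree q < j"
  shows "E (poly (h * q)) = 0"
proof -
  interpret pair: pair_prob_space \<mu> \<mu> ..
  let ?y = "basis 0"
  note y = basis0_in_S
  obtain g where g: "degree g \<le> degree q"
    "\<forall>x\<in>S. \<forall>y\<in>S. (\<integral>z. poly p (dot x z) * poly q (dot y z) \<partial>\<mu>) = poly g (dot x y)"
    using convolution_poly by blast
  let ?F = "\<lambda>x z. poly p (dot x z) * poly (P j) (dot ?y z) * poly q (dot ?y x)"
  have [measurable]: "poly r \<in> borel_measurable borel" for r :: "real poly"
    by (intro continuous_measurable continuous_on_poly')
  have "integrable (\<mu> \<Otimes>\<^sub>M \<mu>) (case_prod ?F)"
  proof -
    obtain A where A: "\<forall>u\<in>{-1..1}. \<bar>poly p u\<bar> \<le> A" "A > 0"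
      using continuous_bounded[OF continuous_on_poly'] by blast
    obtain B where B: "\<forall>u\<in>{-1..1}. \<bar>poly (P j) u\<bar> \<le> B" "B > 0"
      using continuous_bounded[OF continuous_on_poly'] by blast
    obtain C where C: "\<forall>u\<in>{-1..1}. \<bar>poly q u\<bar> \<le> C" "C > 0"
      using continuous_bounded[OF continuous_on_poly'] by blast
    have "\<bar>?F x z\<bar> \<le> A * B * C" if "x \<in> S" "z \<in> S" for x z
      unfolding abs_mult using that A B C y by (intro mult_mono bspec[OF A(1)] bspec[OF B(1)] bspec[OF C(1)] vdot_in_Icc) auto
    then show ?thesis
      by (intro pair.integrable_const_bound[of _ "A * B * C"])
        (auto simp: space_pair_measure space_\<mu> split_beta)
  qed
  then have "(\<integral>z. \<integral>x. ?F x z \<partial>\<mu> \<partial>\<mu>) = (\<integral>x. \<integral>z. ?F x z \<partial>\<mu> \<partial>\<mu>)"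
    by (rule pair.Fubini_integral)
  moreover have "(\<integral>x. \<integral>z. ?F x z \<partial>\<mu> \<partial>\<mu>) = E (poly (h * q))"
    unfolding E_def
    by (intro Bochner_Integration.integral_cong refl)
      (simp add: space_\<mu> h y vdot_commute[of n _ "basis 0"])
  moreover have "(\<integral>z. \<integral>x. ?F x z \<partial>\<mu> \<partial>\<mu>) = E (poly (g * P j))"
    unfolding E_def
  proof (intro Bochner_Integration.integral_cong refl)
    fix z assume "z \<in> space \<mu>"
    then have z: "z \<in> S" by (simp add: space_\<mu>)
    have "(\<integral>x. ?F x z \<partial>\<mu>) = (\<integral>x. poly (P j) (dot ?y z) * (poly p (dot z x) * poly q (dot ?y x)) \<partial>\<mu>)"
      by (simp add: vdot_commute[of n _ z] mult_ac)
    also have "\<dots> = poly (P j) (dot ?y z) * poly g (dot z ?y)"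
      using g(2)[rule_format, OF z y] by simp
    also have "\<dots> = poly (g * P j) (dot ?y z)"
      by (simp add: vdot_commute[of n z ?y] mult.commute)
    finally show "(\<integral>x. ?F x z \<partial>\<mu>) = poly (g * P j) (dot ?y z)" .
  qed
  moreover have "E (poly (g * P j)) = 0"
    using L_mult_ultra[of g j] g(1) q by simp
  ultimately show ?thesis by simp
qed

text \<open>For i \<le> j the convolution is a polynomial in the inner product of degree at most i
  that is orthogonal to every P l with l < j. Only a multiple of P j can remain, and only if i =
  j.\<close>

lemma ultra_convolution:
  assumes x: "x \<in> S" and y: "y \<in> S"
  shows "(\<integral>z. poly (P i) (dot x z) * poly (P j) (dot y z) \<partial>\<mu>)
    = (if i = j then \<nu> j * poly (P j) (dot x y) else 0)"
proof -
  have le: "(\<integral>z. poly (P i) (dot x z) * poly (P j) (dot y z) \<partial>\<mu>)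
    = (if i = j then \<nu> j * poly (P j) (dot x y) else 0)" if "i \<le> j" "x \<in> S" "y \<in> S" for i j x y
  proof -
    \<comment> \<open>\<open>P i\<close> is put second because \<open>convolution_poly\<close>
      bounds the degree by that of its second factor.\<close>
    obtain h where h: "degree h \<le> degree (P i)"
      "\<forall>y\<in>S. \<forall>x\<in>S. (\<integral>z. poly (P j) (dot y z) * poly (P i) (dot x z) \<partial>\<mu>) = poly h (dot y x)"
      using convolution_poly by blast
    then have h': "(\<integral>z. poly (P i) (dot x z) * poly (P j) (dot y z) \<partial>\<mu>) = poly h (dot x y)"
      if "x \<in> S" "y \<in> S" for x y
      using that h(2)[rule_format, of y x] by (simp add: mult.commute vdot_commute)
    have low: "E (poly (h * P l)) = 0" if "l < j" for l
      using that degree_ultra[of "real n - 2" l] by (intro convolution_lower[OF h']) auto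
    have exp: "h = (\<Sum>l\<le>i. smult (E (poly (h * P l)) / \<nu> l) (P l))"
      using h(1) degree_ultra[of "real n - 2" i] by (intro ultra_expansion) simp
    show ?thesis
    proof (cases "i = j")
      case False
      then have "h = 0" using exp low \<open>i \<le> j\<close> by (metis (no_types, lifting) atMost_iff div_0 order.not_eq_order_implies_strict order_le_less_trans smult_0_left sum.neutral)
      then show ?thesis using h'[OF that(2,3)] False by simp
    next
      case True
      define c where "c = E (poly (h * P j)) / \<nu> j"
      have "(\<Sum>l\<le>i. smult (E (poly (h * P l)) / \<nu> l) (P l)) = (\<Sum>l\<le>i. if l = j then smult c (P j) else 0)"
        using True by (intro sum.cong refl) (auto simp: low c_def)
      then have hc: "h = smult c (P j)"
        using exp True by simp
      \<comment> \<open>The factor is read off at x = y, where P j takes the value 1 and the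
        convolution is the norm of P j.\<close>
      have "c = poly h 1"
        using poly_ultra_1[of "real n - 2" j] n2 by (simp add: hc)
      also have "\<dots> = (\<integral>z. poly (P i) (dot (basis 0) z) * poly (P j) (dot (basis 0) z) \<partial>\<mu>)"
        by (subst h') (auto simp: basis0_in_S vdot_self)
      also have "\<dots> = \<nu> j"
        unfolding \<nu>_def by (simp add: E_def True)
      finally show ?thesis using h'[OF that(2,3)] True by (simp add: hc)
    qed
  qed
  show ?thesis
  proof (cases "i \<le> j")
    case True
    then show ?thesis using le x y by simp
  next
    case False
    then have "(\<integral>z. poly (P j) (dot y z) * poly (P i) (dot x z) \<partial>\<mu>) = 0"
      using le[of j i y x] x y by simp
    then show ?thesis using False by (simp add: mult.commute)
  qed
qed

text \<open>For polynomials, expand in the P l and use \<open>ultra_convolution\<close>; continuous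
  functions follow by uniform approximation.\<close>

lemma funk_hecke:
  assumes f: "continuous_on UNIV f" and x: "x \<in> S" and y: "y \<in> S"
  shows "(\<integral>z. f (dot x z) * poly (P j) (dot y z) \<partial>\<mu>)
    = E (\<lambda>u. f u * poly (P j) u) * poly (P j) (dot x y)"
proof -
  note cont = continuous_on_poly'
  obtain B where B: "\<forall>u\<in>{-1..1}. \<bar>poly (P j) u\<bar> \<le> B" "B > 0"
    using continuous_bounded[OF cont] by blast
  have poly: "(\<integral>z. poly p (dot x z) * poly (P j) (dot y z) \<partial>\<mu>)
    = E (\<lambda>u. poly p u * poly (P j) u) * poly (P j) (dot x y)" for p
  proof -
    \<comment> \<open>The maximum ensures that the index j occurs in the expansion even if p has
      smaller degree.\<close>
    define N where "N = max j (degree p)"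
    define c where "c l = E (poly (p * P l)) / \<nu> l" for l
    have p: "p = (\<Sum>l\<le>N. smult (c l) (P l))"
      unfolding c_def by (rule ultra_expansion) (simp add: N_def)
    have "(\<integral>z. poly p (dot x z) * poly (P j) (dot y z) \<partial>\<mu>)
      = (\<integral>z. (\<Sum>l\<le>N. c l * (poly (P l) (dot x z) * poly (P j) (dot y z))) \<partial>\<mu>)"
      by (subst p) (simp add: poly_sum sum_distrib_right mult.assoc)
    also have "\<dots> = (\<Sum>l\<le>N. c l * (\<integral>z. poly (P l) (dot x z) * poly (P j) (dot y z) \<partial>\<mu>))"
      using x y by (subst Bochner_Integration.integral_sum) (auto intro!: integrable_dot2 cont integrable_mult_right)
    also have "\<dots> = (\<Sum>l\<le>N. if l = j then c j * \<nu> j * poly (P j) (dot x y) else 0)"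
      using ultra_convolution[OF x y] by (intro sum.cong) auto
    also have "\<dots> = E (poly (p * P j)) * poly (P j) (dot x y)"
      using \<nu>_pos[of j] by (simp add: N_def c_def)
    finally show ?thesis by (simp add: poly_mult[abs_def])
  qed
  \<comment> \<open>The integral contributes an error \<epsilon> B; the coefficient also contributes
    \<epsilon> B, multiplied by a value of P j bounded by B.\<close>
  show ?thesis
  proof (rule approx_eqI[OF f, where C = "B + B * B"])
    fix \<epsilon> :: real and p
    assume \<epsilon>: "\<epsilon> > 0" and *: "\<forall>u\<in>{-1..1}. \<bar>f u - poly p u\<bar> \<le> \<epsilon>"
    have close: "\<bar>(\<integral>z. f (dot x z) * poly (P j) (dot y z) \<partial>\<mu>) - (\<integral>z. poly p (dot x z) * poly (P j) (dot y z) \<partial>\<mu>)\<bar> \<le> \<epsilon> * B"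
      if "x \<in> S" "y \<in> S" for x y
    proof (rule integral_close)
      fix z assume z: "z \<in> S"
      show "\<bar>f (dot x z) * poly (P j) (dot y z) - poly p (dot x z) * poly (P j) (dot y z)\<bar> \<le> \<epsilon> * B"
        unfolding left_diff_distrib[symmetric] abs_mult
        using that z \<epsilon> by (intro mult_mono bspec[OF *] bspec[OF B(1)] vdot_in_Icc) auto
    qed (use that in \<open>auto intro!: integrable_dot2 f cont\<close>)
    have "\<bar>E (\<lambda>u. f u * poly (P j) u) * poly (P j) (dot x y) - E (\<lambda>u. poly p u * poly (P j) u) * poly (P j) (dot x y)\<bar> \<le> (\<epsilon> * B) * B"
      unfolding left_diff_distrib[symmetric] abs_mult
      using close[OF basis0_in_S basis0_in_S] x y \<epsilon> B(2)
      by (intro mult_mono bspec[OF B(1)] vdot_in_Icc) (auto simp: E_def)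
    then show "\<bar>(\<integral>z. f (dot x z) * poly (P j) (dot y z) \<partial>\<mu>) - E (\<lambda>u. f u * poly (P j) u) * poly (P j) (dot x y)\<bar> \<le> (B + B * B) * \<epsilon>"
      using close[OF x y] unfolding poly by (simp add: algebra_simps)
  qed
qed

end

section \<open>Functions of positive type\<close>

text \<open>Uniform continuity handles nearby points; for distant ones the quadratic term exceeds
  twice the bound on f. Convergence of the kernels thereby reduces to one second-order moment, as in
  Korovkin's theorem.\<close>

lemma uniform_quadratic_modulus:
  fixes f :: "real \<Rightarrow> real"
  assumes "continuous_on UNIV f" "\<epsilon> > 0"
  shows "\<exists>K\<ge>0. \<forall>u\<in>{-1..1}. \<forall>v\<in>{-1..1}. \<bar>f u - f v\<bar> \<le> \<epsilon> + K * (u - v)\<^sup>2"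
proof -
  have "continuous_on {-1..1} f"
    using assms(1) by (rule continuous_on_subset) simp
  then have "uniformly_continuous_on {-1..1} f"
    by (intro compact_uniformly_continuous) auto
  then obtain \<delta> where \<delta>: "\<delta> > 0" "\<forall>u\<in>{-1..1}. \<forall>v\<in>{-1..1}. dist v u < \<delta> \<longrightarrow> dist (f v) (f u) < \<epsilon>"
    using assms(2) unfolding uniformly_continuous_on_def by blast
  have "compact (f ` {-1..1})"
    using \<open>continuous_on {-1..1} f\<close> by (intro compact_continuous_image) auto
  then obtain B where B: "\<forall>v\<in>f ` {-1..1}. norm v \<le> B"
    using compact_imp_bounded bounded_iff by metis
  define K where "K = 2 * \<bar>B\<bar> / \<delta>\<^sup>2"
  have "\<bar>f u - f v\<bar> \<le> \<epsilon> + K * (u - v)\<^sup>2" if "u \<in> {-1..1}" "v \<in> {-1..1}" for u v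
  proof (cases "\<bar>u - v\<bar> < \<delta>")
    case True
    then have "\<bar>f u - f v\<bar> < \<epsilon>"
      using \<delta>(2) that by (simp add: dist_real_def)
    moreover have "K * (u - v)\<^sup>2 \<ge> 0" by (simp add: K_def)
    ultimately show ?thesis by linarith
  next
    case False
    then have "\<delta>\<^sup>2 \<le> (u - v)\<^sup>2"
      using \<delta>(1) power_mono[of \<delta> "\<bar>u - v\<bar>" 2] by simp
    then have "2 * \<bar>B\<bar> * 1 \<le> 2 * \<bar>B\<bar> * ((u - v)\<^sup>2 / \<delta>\<^sup>2)"
      using \<delta>(1) by (intro mult_left_mono) auto
    then have "2 * \<bar>B\<bar> \<le> K * (u - v)\<^sup>2"
      by (simp add: K_def)
    moreover have "\<bar>f u\<bar> \<le> B" "\<bar>f v\<bar> \<le> B"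
      using B that by auto
    ultimately show ?thesis using assms(2) by linarith
  qed
  moreover have "K \<ge> 0" by (simp add: K_def)
  ultimately show ?thesis by blast
qed

text \<open>Positive semidefiniteness is defined on sets, but sampled points may coincide; weights
  at equal points are added up.\<close>

lemma psd_on_family:
  fixes x :: "nat \<Rightarrow> 'a" and c :: "nat \<Rightarrow> real"
  assumes "psd_on (x ` {..<N}) A"
  shows "(\<Sum>i<N. \<Sum>j<N. A (x i) (x j) * c i * c j) \<ge> 0"
proof -
  define C where "C u = (\<Sum>i | i \<in> {..<N} \<and> x i = u. c i)" for u
  have inner: "(\<Sum>j<N. g (x j) * c j) = (\<Sum>v\<in>x ` {..<N}. g v * C v)" for g :: "'a \<Rightarrow> real"
  proof -
    have "(\<Sum>j<N. g (x j) * c j) = (\<Sum>v\<in>x ` {..<N}. \<Sum>j | j \<in> {..<N} \<and> x j = v. g (x j) * c j)"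
      by (rule sum.image_gen) simp
    also have "\<dots> = (\<Sum>v\<in>x ` {..<N}. g v * C v)"
      by (intro sum.cong refl) (simp add: C_def sum_distrib_left)
    finally show ?thesis .
  qed
  have "(\<Sum>i<N. \<Sum>j<N. A (x i) (x j) * c i * c j) = (\<Sum>i<N. (\<Sum>j<N. A (x i) (x j) * c j) * c i)"
    unfolding sum_distrib_right by (intro sum.cong refl) (simp add: mult_ac)
  also have "\<dots> = (\<Sum>i<N. (\<Sum>v\<in>x ` {..<N}. A (x i) v * C v) * c i)"
    unfolding inner ..
  also have "\<dots> = (\<Sum>u\<in>x ` {..<N}. (\<Sum>v\<in>x ` {..<N}. A u v * C v) * C u)"
    by (rule inner)
  also have "\<dots> = (\<Sum>u\<in>x ` {..<N}. \<Sum>v\<in>x ` {..<N}. A u v * C u * C v)"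
    unfolding sum_distrib_right by (intro sum.cong refl) (simp add: mult_ac)
  also have "\<dots> \<ge> 0"
    using assms unfolding psd_on_def by blast
  finally show ?thesis .
qed

section \<open>Nonnegativity of the ultraspherical coefficients\<close>

context sphere
begin

lemma ultra_1: "poly (P j) 1 = 1"
  using poly_ultra_1[of "real n - 2" j] n2 by simp

definition coef :: "(real \<Rightarrow> real) \<Rightarrow> nat \<Rightarrow> real" where
  "coef f j = E (\<lambda>u. f u * poly (P j) u)"

text \<open>The average of the quadratic form of \<open>f\<close> over \<open>N\<close> fixed points and \<open>k\<close> independent random
  ones carrying the weights \<open>P j (dot e y)\<close>; the random points are integrated out one at a time.\<close>

lemma positive_type_averaged:
  fixes N :: nat and c :: "nat \<Rightarrow> real"
  assumes f: "continuous_on UNIV f" and pt: "positive_type n f" and e: "e \<in> S"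
    and x: "\<And>i. i < N \<Longrightarrow> x i \<in> S"
  shows "0 \<le> (\<Sum>i<N. \<Sum>j<N. f (dot (x i) (x j)) * c i * c j)
    + 2 * real k * coef f m * (\<Sum>i<N. c i * poly (P m) (dot e (x i)))
    + real k * \<nu> m * f 1 + real k * (real k - 1) * coef f m * \<nu> m"
  using x
proof (induction k arbitrary: N x c)
  case 0
  have "x ` {..<N} \<subseteq> S" using 0 by auto
  then have "psd_on (x ` {..<N}) (\<lambda>x y. f (dot x y))"
    by (intro pt[unfolded positive_type_def, rule_format]) auto
  from psd_on_family[OF this, of c] show ?case by simp
next
  case (Suc k)
  define a where "a = coef f m"
  let ?\<phi> = "\<lambda>y. poly (P m) (dot e y)"
  define Q where "Q = (\<Sum>i<N. \<Sum>j<N. f (dot (x i) (x j)) * c i * c j)"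
  define R where "R = (\<Sum>i<N. c i * ?\<phi> (x i))"
  define s where "s y = (\<Sum>i<N. c i * (f (dot (x i) y) * ?\<phi> y))" for y
  define A where "A = Q + 2 * real k * a * R + real k * \<nu> m * f 1 + real k * (real k - 1) * a * \<nu> m"
  define B where "B = f 1 + 2 * real k * a"
  \<comment> \<open>The induction hypothesis for the N given points together with y, weighted by P m
    (dot e y). The new point's cross terms form \<open>s\<close>, its diagonal term goes into
    \<open>B\<close>; integration over y then gives the claim.\<close>
  have T: "0 \<le> A + 2 * s y + B * (?\<phi> y * ?\<phi> y)" if y: "y \<in> S" for y
  proof -
    let ?x = "x(N := y)" and ?c = "c(N := ?\<phi> y)"
    have split: "(\<Sum>i<Suc N. \<Sum>j<Suc N. g i j) = (\<Sum>i<N. \<Sum>j<N. g i j) + (\<Sum>i<N. g i N) + (\<Sum>j<N. g N j) + g N N"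
      for g :: "nat \<Rightarrow> nat \<Rightarrow> real"
      by (simp add: sum.distrib)
    have *: "(\<Sum>i<N. f (dot (x i) y) * c i * ?\<phi> y) = s y" "(\<Sum>j<N. f (dot y (x j)) * ?\<phi> y * c j) = s y"
      unfolding s_def by (auto intro!: sum.cong simp: vdot_commute[of n y] mult_ac)
    have 1: "(\<Sum>i<Suc N. \<Sum>j<Suc N. f (dot (?x i) (?x j)) * ?c i * ?c j)
      = Q + 2 * s y + f 1 * (?\<phi> y * ?\<phi> y)"
      unfolding split using * by (simp add: Q_def vdot_self[OF y])
    have 2: "(\<Sum>i<Suc N. ?c i * ?\<phi> (?x i)) = R + ?\<phi> y * ?\<phi> y"
      by (simp add: R_def)
    have "0 \<le> (\<Sum>i<Suc N. \<Sum>j<Suc N. f (dot (?x i) (?x j)) * ?c i * ?c j)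
      + 2 * real k * coef f m * (\<Sum>i<Suc N. ?c i * ?\<phi> (?x i))
      + real k * \<nu> m * f 1 + real k * (real k - 1) * coef f m * \<nu> m"
      by (rule Suc.IH) (use Suc.prems y in \<open>auto simp: less_Suc_eq\<close>)
    then show ?thesis
      unfolding 1 2 A_def B_def a_def by (simp add: algebra_simps)
  qed
  have int: "integrable \<mu> (\<lambda>y. f (dot (x i) y) * ?\<phi> y)" if "i < N" for i
    using Suc.prems[OF that] e by (intro integrable_dot2 f continuous_on_poly')
  have ints: "integrable \<mu> s"
    unfolding s_def by (intro Bochner_Integration.integrable_sum integrable_mult_right int) simp
  have int2: "integrable \<mu> (\<lambda>y. ?\<phi> y * ?\<phi> y)"
    using e by (intro integrable_dot2 continuous_on_poly')
  have "(\<integral>y. s y \<partial>\<mu>) = (\<Sum>i<N. c i * (\<integral>y. f (dot (x i) y) * ?\<phi> y \<partial>\<mu>))"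
    unfolding s_def by (subst Bochner_Integration.integral_sum) (auto intro: int)
  also have "\<dots> = a * R"
    unfolding R_def sum_distrib_left
  proof (intro sum.cong refl)
    fix i assume "i \<in> {..<N}"
    then show "c i * (\<integral>y. f (dot (x i) y) * ?\<phi> y \<partial>\<mu>) = a * (c i * ?\<phi> (x i))"
      using funk_hecke[OF f Suc.prems[of i] e, of m]
      by (simp add: coef_def a_def vdot_commute[of n e])
  qed
  finally have s: "(\<integral>y. s y \<partial>\<mu>) = a * R" .
  have \<phi>: "(\<integral>y. ?\<phi> y * ?\<phi> y \<partial>\<mu>) = \<nu> m"
    using ultra_convolution[OF e e, of m m] by (simp add: vdot_self[OF e] ultra_1)
  have "0 \<le> (\<integral>y. A + 2 * s y + B * (?\<phi> y * ?\<phi> y) \<partial>\<mu>)"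
    using T by (intro integral_nonneg_AE) (auto simp: space_\<mu>)
  also have "\<dots> = A + 2 * (\<integral>y. s y \<partial>\<mu>) + B * (\<integral>y. ?\<phi> y * ?\<phi> y \<partial>\<mu>)"
    using ints int2 by (simp add: prob_space)
  finally show ?case
    unfolding s \<phi> by (simp add: A_def B_def Q_def R_def a_def algebra_simps)
qed

text \<open>With no fixed points, the diagonal of the averaged form grows like k and the
  off-diagonal part like k^2 times the coefficient. A negative coefficient would win for large
  k.\<close>

lemma coef_nonneg:
  assumes f: "continuous_on UNIV f" and pt: "positive_type n f"
  shows "coef f m \<ge> 0"
proof (rule ccontr)
  assume "\<not> coef f m \<ge> 0"
  then have neg: "- (coef f m * \<nu> m) > 0"
    using \<nu>_pos[of m] by (simp add: mult_neg_pos)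
  then obtain k :: nat where k: "\<nu> m * f 1 < real k * - (coef f m * \<nu> m)"
    using reals_Archimedean3 by blast
  have "0 \<le> real (Suc k) * \<nu> m * f 1 + real (Suc k) * (real (Suc k) - 1) * coef f m * \<nu> m"
    using positive_type_averaged[OF f pt basis0_in_S, of 0 _ _ "Suc k" m] by simp
  also have "\<dots> = real (Suc k) * (\<nu> m * f 1 - real k * - (coef f m * \<nu> m))"
    by (simp add: algebra_simps)
  also have "\<dots> < 0" using k by (intro mult_pos_neg) auto
  finally show False by simp
qed

lemma coef_0: "coef f 0 = E f"
  by (simp add: coef_def)

lemma sphere_integral_eq_E:
  assumes "continuous_on UNIV f"
  shows "sphere_integral n f = E f"
proof -
  have "sphere_integral n f = (\<integral>x. E f \<partial>\<mu>)"
    unfolding sphere_integral_def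
    by (intro Bochner_Integration.integral_cong refl E_invariant assms) (simp add: space_\<mu>)
  then show ?thesis by (simp add: prob_space)
qed

text \<open>By \<open>ultra_convolution\<close>, \<nu> j > 0 times the quadratic form is the
  integral of a square.\<close>

lemma positive_type_ultra: "positive_type n (poly (P j))"
  unfolding positive_type_def psd_on_def
proof (intro allI impI conjI ballI)
  fix U :: "(nat \<Rightarrow> real) set" and c :: "(nat \<Rightarrow> real) \<Rightarrow> real"
  assume U: "finite U" "U \<subseteq> S"
  have "\<nu> j * (\<Sum>x\<in>U. \<Sum>y\<in>U. poly (P j) (dot x y) * c x * c y)
    = (\<Sum>x\<in>U. \<Sum>y\<in>U. (c x * c y) * (\<integral>z. poly (P j) (dot x z) * poly (P j) (dot y z) \<partial>\<mu>))"
    unfolding sum_distrib_left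
    by (intro sum.cong refl) (simp add: ultra_convolution subsetD[OF U(2)] mult_ac)
  also have "\<dots> = (\<integral>z. (\<Sum>x\<in>U. \<Sum>y\<in>U. (c x * c y) * (poly (P j) (dot x z) * poly (P j) (dot y z))) \<partial>\<mu>)"
  proof -
    have "integrable \<mu> (\<lambda>z. (c x * c y) * (poly (P j) (dot x z) * poly (P j) (dot y z)))"
      if "x \<in> U" "y \<in> U" for x y
      using that U by (intro integrable_mult_right integrable_dot2 continuous_on_poly') auto
    then show ?thesis
      by (simp add: Bochner_Integration.integral_sum Bochner_Integration.integrable_sum del: integral_mult_right)
  qed
  also have "\<dots> = (\<integral>z. (\<Sum>x\<in>U. c x * poly (P j) (dot x z))\<^sup>2 \<partial>\<mu>)"
    by (simp add: power2_eq_square sum_product mult_ac)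
  also have "\<dots> \<ge> 0" by simp
  finally show "(\<Sum>x\<in>U. \<Sum>y\<in>U. poly (P j) (dot x y) * c x * c y) \<ge> 0"
    using \<nu>_pos[of j] by (simp add: zero_le_mult_iff)
qed (simp add: vdot_commute)

end

section \<open>Peaked polynomial kernels\<close>

context sphere
begin

text \<open>On \<open>[-1, 1]\<close> these polynomials are nonnegative and their mass concentrates at \<open>1\<close>.\<close>

definition peak :: "nat \<Rightarrow> real poly" where
  "peak m = smult (1 / \<kappa> (2 * m)) (monom 1 (2 * m) + monom 1 (2 * m + 1))"

lemma poly_peak: "poly (peak m) u = u ^ (2 * m) * (1 + u) / \<kappa> (2 * m)"
  by (simp add: peak_def poly_monom algebra_simps add_divide_distrib)

lemma poly_peak_nonneg: "u \<in> {-1..1} \<Longrightarrow> poly (peak m) u \<ge> 0"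
  using \<kappa>_even_pos[of m] by (simp add: poly_peak)

lemma E_monom: "E (poly (monom 1 i)) = \<kappa> i"
  by (simp add: \<kappa>_def poly_monom[abs_def])

lemma E_peak: "E (poly (peak m)) = 1"
proof -
  have "E (poly (peak m)) = (1 / \<kappa> (2 * m)) * (\<kappa> (2 * m) + \<kappa> (2 * m + 1))"
    unfolding peak_def L_smult L_add E_monom ..
  then show ?thesis using \<kappa>_even_pos[of m] by (simp add: \<kappa>_odd)
qed

text \<open>The factor 1 + u, which suppresses the second peak of u^(2m) at -1, combines with 1 - u
  to give a difference of consecutive even moments. The mean of 1 - u thus decays like 1 /
  m.\<close>

lemma E_peak_moment: "E (poly (peak m * [:1, -1:])) = (real n - 1) / (2 * real m + real n)"
proof -
  have "peak m * [:1, -1:] = smult (1 / \<kappa> (2 * m)) (monom 1 (2 * m) - monom 1 (2 * m + 2))"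
    by (rule poly_eq_poly_eq_iff[THEN iffD1], rule ext)
      (simp add: poly_peak poly_monom algebra_simps power2_eq_square add_divide_distrib diff_divide_distrib)
  then have "E (poly (peak m * [:1, -1:])) = (1 / \<kappa> (2 * m)) * (\<kappa> (2 * m) - \<kappa> (2 * m + 2))"
    by (simp only: L_smult L_diff E_monom)
  also have "\<kappa> (2 * m + 2) = (2 * real m + 1) / (2 * real m + real n) * \<kappa> (2 * m)"
    using \<kappa>_rec[of "2 * m"] n2 by (simp add: field_simps)
  also have "1 / \<kappa> (2 * m) * (\<kappa> (2 * m) - (2 * real m + 1) / (2 * real m + real n) * \<kappa> (2 * m))
      = 1 - (2 * real m + 1) / (2 * real m + real n)"
    using \<kappa>_even_pos[of m] by (simp add: right_diff_distrib)
  also have "\<dots> = (real n - 1) / (2 * real m + real n)"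
    using n2 by (simp add: field_simps)
  finally show ?thesis .
qed

text \<open>Nonnegativity comes from the monomials, and \<open>b 0\<close> is the mean of the
  kernel. Since it equals 1, convolution leaves the constant coefficient of f unchanged.\<close>

lemma peak_expansion:
  "\<exists>b. (\<forall>l. b l \<ge> 0) \<and> b 0 = 1 \<and> peak m = (\<Sum>l\<le>2 * m + 1. smult (b l) (P l))"
proof -
  have "monom 1 (2 * m) \<in> ultra_cone (2 * m + 1)"
    using monom_in_cone[of "2 * m"] ultra_cone_mono[of "2 * m" "2 * m + 1"] by auto
  then have "peak m \<in> ultra_cone (2 * m + 1)"
    unfolding peak_def using \<kappa>_even_pos[of m] monom_in_cone
    by (intro ultra_cone_smult ultra_cone_add) auto
  then obtain b where b: "\<forall>l. b l \<ge> 0" "peak m = (\<Sum>l\<le>2 * m + 1. smult (b l) (P l))"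
    unfolding ultra_cone_def by blast
  have "b 0 = E (poly (peak m * P 0))"
    using L_ultra_sum[of b "2 * m + 1" 0] by (simp only: b(2)) simp
  then have "b 0 = 1" using E_peak by simp
  with b show ?thesis by blast
qed

text \<open>The quadratic modulus of f, \<open>sq\<close> and \<open>E_peak_moment\<close> bound the
  error by \<epsilon> / 2 plus a multiple of 1 / (2 m + n).\<close>

lemma peak_convolution_tendsto:
  assumes f: "continuous_on UNIV f" and x: "x \<in> S" and y: "y \<in> S"
  shows "(\<lambda>m. \<integral>z. f (dot x z) * poly (peak m) (dot y z) \<partial>\<mu>) \<longlonglongrightarrow> f (dot x y)"
proof (rule LIMSEQ_I)
  fix \<epsilon> :: real assume \<epsilon>: "\<epsilon> > 0"
  obtain K where K: "K \<ge> 0" "\<forall>u\<in>{-1..1}. \<forall>v\<in>{-1..1}. \<bar>f u - f v\<bar> \<le> \<epsilon> / 2 + K * (u - v)\<^sup>2"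
    using uniform_quadratic_modulus[OF f half_gt_zero[OF \<epsilon>]] by blast
  obtain N :: nat where N: "2 * K * (real n - 1) < real N * (\<epsilon> / 2)"
    using reals_Archimedean3[OF half_gt_zero[OF \<epsilon>]] by blast
  show "\<exists>N. \<forall>m\<ge>N. norm ((\<integral>z. f (dot x z) * poly (peak m) (dot y z) \<partial>\<mu>) - f (dot x y)) < \<epsilon>"
  proof (intro exI allI impI)
    fix m assume m: "N \<le> m"
    let ?q = "poly (peak m)"
    \<comment> \<open>Cauchy-Schwarz against z - y, whose squared norm is 2 (1 - dot y z) for unit
      vectors.\<close>
    have sq: "(dot x z - dot x y)\<^sup>2 \<le> 2 * (1 - dot y z)" if z: "z \<in> S" for z
    proof -
      let ?d = "\<lambda>i. z i - y i"
      have "\<bar>dot x ?d\<bar> \<le> vnorm n x * vnorm n ?d"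
        using L2_set_mult_ineq[of x ?d "{..<n}"] sum_abs[of "\<lambda>i. x i * ?d i" "{..<n}"]
        by (simp add: vdot_def vnorm_def L2_set_def abs_mult)
      then have "\<bar>dot x ?d\<bar> \<le> vnorm n ?d"
        using x by (simp add: unit_sphere_def)
      then have "(dot x ?d)\<^sup>2 \<le> (vnorm n ?d)\<^sup>2"
        using power_mono[of "\<bar>dot x ?d\<bar>" "vnorm n ?d" 2] by simp
      also have "\<dots> = dot z z - 2 * dot y z + dot y y"
        unfolding vnorm_sq
        by (simp add: vdot_def sum.distrib sum_subtractf sum_distrib_left algebra_simps)
      also have "dot x ?d = dot x z - dot x y"
        by (simp add: vdot_def sum_subtractf algebra_simps)
      finally show ?thesis using y z by (simp add: vdot_self)
    qed
    have int: "integrable \<mu> (\<lambda>z. f (dot x z) * ?q (dot y z))"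
      by (intro integrable_dot2 f continuous_on_poly' x y)
    have intq: "integrable \<mu> (\<lambda>z. poly p (dot y z))" for p
      by (intro integrable_dot continuous_on_poly' y)
    have diff: "(\<integral>z. f (dot x z) * ?q (dot y z) \<partial>\<mu>) - f (dot x y)
      = (\<integral>z. f (dot x z) * ?q (dot y z) - f (dot x y) * ?q (dot y z) \<partial>\<mu>)"
    proof -
      have "(\<integral>z. f (dot x z) * ?q (dot y z) - f (dot x y) * ?q (dot y z) \<partial>\<mu>)
        = (\<integral>z. f (dot x z) * ?q (dot y z) \<partial>\<mu>) - (\<integral>z. f (dot x y) * ?q (dot y z) \<partial>\<mu>)"
        by (rule Bochner_Integration.integral_diff[OF int integrable_mult_right[OF intq]])
      then show ?thesis
        unfolding integral_mult_right_zero E_poly[OF y] E_peak by (simp only: mult_1_right)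
    qed
    have "\<bar>(\<integral>z. f (dot x z) * ?q (dot y z) \<partial>\<mu>) - f (dot x y)\<bar> \<le> (\<integral>z. \<bar>f (dot x z) * ?q (dot y z) - f (dot x y) * ?q (dot y z)\<bar> \<partial>\<mu>)"
      unfolding diff by (rule integral_abs_bound)
    also have "\<dots> \<le> (\<integral>z. (\<epsilon> / 2) * ?q (dot y z) + (2 * K) * poly (peak m * [:1, -1:]) (dot y z) \<partial>\<mu>)"
    proof (rule integral_mono)
      show "integrable \<mu> (\<lambda>z. \<bar>f (dot x z) * ?q (dot y z) - f (dot x y) * ?q (dot y z)\<bar>)"
        by (intro integrable_abs Bochner_Integration.integrable_diff integrable_mult_right int intq)
      show "integrable \<mu> (\<lambda>z. (\<epsilon> / 2) * ?q (dot y z) + (2 * K) * poly (peak m * [:1, -1:]) (dot y z))"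
        by (intro Bochner_Integration.integrable_add integrable_mult_right intq)
      fix z assume "z \<in> space \<mu>"
      then have z: "z \<in> S" by (simp add: space_\<mu>)
      have q: "?q (dot y z) \<ge> 0"
        by (intro poly_peak_nonneg vdot_in_Icc y z)
      have "\<bar>f (dot x z) - f (dot x y)\<bar> \<le> \<epsilon> / 2 + K * (dot x z - dot x y)\<^sup>2"
        by (rule K(2)[rule_format, OF vdot_in_Icc[OF x z] vdot_in_Icc[OF x y]])
      also have "\<dots> \<le> \<epsilon> / 2 + K * (2 * (1 - dot y z))"
        using sq[OF z] K(1) by (intro add_left_mono mult_left_mono)
      finally have "\<bar>f (dot x z) - f (dot x y)\<bar> * ?q (dot y z) \<le> (\<epsilon> / 2 + K * (2 * (1 - dot y z))) * ?q (dot y z)"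
        using q by (rule mult_right_mono)
      moreover have "\<bar>f (dot x z) * ?q (dot y z) - f (dot x y) * ?q (dot y z)\<bar> = \<bar>f (dot x z) - f (dot x y)\<bar> * ?q (dot y z)"
        using q by (simp add: left_diff_distrib[symmetric] abs_mult)
      ultimately show "\<bar>f (dot x z) * ?q (dot y z) - f (dot x y) * ?q (dot y z)\<bar>
        \<le> (\<epsilon> / 2) * ?q (dot y z) + (2 * K) * poly (peak m * [:1, -1:]) (dot y z)"
        by (simp add: algebra_simps)
    qed
    also have "\<dots> = \<epsilon> / 2 * E (poly (peak m)) + 2 * K * E (poly (peak m * [:1, -1:]))"
    proof -
      have "(\<integral>z. (\<epsilon> / 2) * ?q (dot y z) + (2 * K) * poly (peak m * [:1, -1:]) (dot y z) \<partial>\<mu>)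
        = (\<integral>z. (\<epsilon> / 2) * ?q (dot y z) \<partial>\<mu>) + (\<integral>z. (2 * K) * poly (peak m * [:1, -1:]) (dot y z) \<partial>\<mu>)"
        by (intro Bochner_Integration.integral_add integrable_mult_right intq)
      then show ?thesis unfolding integral_mult_right_zero E_poly[OF y] .
    qed
    also have "\<dots> = \<epsilon> / 2 + 2 * K * (real n - 1) / (2 * real m + real n)"
      by (simp only: E_peak E_peak_moment mult_1_right times_divide_eq_right)
    also have "\<dots> < \<epsilon>"
    proof -
      have "real N * (\<epsilon> / 2) \<le> (2 * real m + real n) * (\<epsilon> / 2)"
        using m \<epsilon> by (intro mult_right_mono) auto
      then have "2 * K * (real n - 1) < (\<epsilon> / 2) * (2 * real m + real n)"
        using N by (simp add: mult.commute)
      then have "2 * K * (real n - 1) / (2 * real m + real n) < \<epsilon> / 2"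
        using n2 by (subst pos_divide_less_eq) auto
      then show ?thesis by simp
    qed
    finally show "norm ((\<integral>z. f (dot x z) * ?q (dot y z) \<partial>\<mu>) - f (dot x y)) < \<epsilon>" by simp
  qed
qed

lemma peak_convolution:
  assumes f: "continuous_on UNIV f" and x: "x \<in> S" and y: "y \<in> S"
    and b: "peak m = (\<Sum>l\<le>N. smult (b l) (P l))"
  shows "(\<integral>z. f (dot x z) * poly (peak m) (dot y z) \<partial>\<mu>) = (\<Sum>l\<le>N. b l * coef f l * poly (P l) (dot x y))"
proof -
  have "(\<integral>z. f (dot x z) * poly (peak m) (dot y z) \<partial>\<mu>)
    = (\<integral>z. (\<Sum>l\<le>N. b l * (f (dot x z) * poly (P l) (dot y z))) \<partial>\<mu>)"
    unfolding b by (simp add: poly_sum sum_distrib_left mult_ac)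
  also have "\<dots> = (\<Sum>l\<le>N. b l * (\<integral>z. f (dot x z) * poly (P l) (dot y z) \<partial>\<mu>))"
    using integrable_dot2[OF f continuous_on_poly' x y]
    by (subst Bochner_Integration.integral_sum) auto
  also have "\<dots> = (\<Sum>l\<le>N. b l * coef f l * poly (P l) (dot x y))"
    by (simp add: funk_hecke[OF f x y] coef_def mult.assoc)
  finally show ?thesis .
qed

lemma exists_sphere_pair:
  assumes "t \<in> {-1..1}"
  shows "\<exists>y\<in>S. dot (basis 0) y = t"
proof
  define y where "y = (\<lambda>i\<in>{..<n}. if i = 0 then t else if i = 1 then sqrt (1 - t\<^sup>2) else 0)"
  show "dot (basis 0) y = t"
    using n2 by (subst dot_basis) (auto simp: y_def)
  have "t\<^sup>2 \<le> 1" using assms by (simp add: abs_square_le_1 abs_le_iff)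
  have "(\<Sum>i<n. (y i)\<^sup>2) = (\<Sum>i\<in>{0, 1}. (y i)\<^sup>2)"
    using n2 by (intro sum.mono_neutral_right) (auto simp: y_def)
  also have "\<dots> = 1"
    using n2 \<open>t\<^sup>2 \<le> 1\<close> by (simp add: y_def)
  finally show "y \<in> S"
    by (simp add: unit_sphere_def vnorm_def space_PiM y_def)
qed

text \<open>For each kernel the convolution is a finite sum whose term l = 0 is exactly E f. The
  other coefficients are nonnegative, so each P l t may be replaced by M; what remains is M times
  the same sum at argument 1. Then m tends to infinity.\<close>

lemma positive_type_lower_bound:
  assumes f: "continuous_on UNIV f" and pt: "positive_type n f"
    and t: "t \<in> {-1..1}" and M: "\<And>l. l \<ge> 1 \<Longrightarrow> M \<le> poly (P l) t"
  shows "E f + M * (f 1 - E f) \<le> f t"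
proof -
  let ?x = "basis 0"
  obtain y where y: "y \<in> S" "dot ?x y = t" using exists_sphere_pair[OF t] by blast
  note x = basis0_in_S
  let ?C = "\<lambda>y m. \<integral>z. f (dot ?x z) * poly (peak m) (dot y z) \<partial>\<mu>"
  have "E f + M * (?C ?x m - E f) \<le> ?C y m" for m
  proof -
    obtain b where b: "\<forall>l. b l \<ge> 0" "b 0 = 1" "peak m = (\<Sum>l\<le>2 * m + 1. smult (b l) (P l))"
      using peak_expansion by blast
    have C: "?C y m = E f + (\<Sum>l\<le>2 * m. b (Suc l) * coef f (Suc l) * poly (P (Suc l)) (dot ?x y))" if "y \<in> S" for y
      unfolding peak_convolution[OF f x that b(3)] using b(2)
      by (simp add: coef_0 sum.atMost_Suc_shift del: sum.atMost_Suc ultra.simps(2,3))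
    have "M * (\<Sum>l\<le>2 * m. b (Suc l) * coef f (Suc l)) = (\<Sum>l\<le>2 * m. b (Suc l) * coef f (Suc l) * M)"
      by (simp add: sum_distrib_left mult_ac)
    also have "\<dots> \<le> (\<Sum>l\<le>2 * m. b (Suc l) * coef f (Suc l) * poly (P (Suc l)) t)"
      using b(1) coef_nonneg[OF f pt] M by (intro sum_mono mult_left_mono mult_nonneg_nonneg) auto
    finally show ?thesis
      unfolding C[OF x] C[OF y(1)] y(2) vdot_self[OF x] ultra_1 by simp
  qed
  moreover have "(\<lambda>m. E f + M * (?C ?x m - E f)) \<longlonglongrightarrow> E f + M * (f 1 - E f)"
    using peak_convolution_tendsto[OF f x x] by (intro tendsto_intros) (simp add: vdot_self[OF x])
  moreover have "?C y \<longlonglongrightarrow> f t"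
    using peak_convolution_tendsto[OF f x y(1)] by (simp add: y(2))
  ultimately show ?thesis
    by (intro LIMSEQ_le) auto
qed

text \<open>At argument 1 every P l equals 1, so the convolution is a sum of nonnegative terms, one
  of which is E f.\<close>

lemma E_le:
  assumes f: "continuous_on UNIV f" and pt: "positive_type n f"
  shows "E f \<le> f 1"
proof -
  note x = basis0_in_S
  have "E f \<le> (\<integral>z. f (dot (basis 0) z) * poly (peak m) (dot (basis 0) z) \<partial>\<mu>)" for m
  proof -
    obtain b where b: "\<forall>l. b l \<ge> 0" "b 0 = 1" "peak m = (\<Sum>l\<le>2 * m + 1. smult (b l) (P l))"
      using peak_expansion by blast
    have "b 0 * coef f 0 \<le> (\<Sum>l\<le>2 * m + 1. b l * coef f l)"
      using b(1) coef_nonneg[OF f pt] by (intro member_le_sum) auto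
    then show ?thesis
      unfolding peak_convolution[OF f x x b(3)] vdot_self[OF x] ultra_1 by (simp add: b(2) coef_0 del: sum.atMost_Suc)
  qed
  then show ?thesis
    using peak_convolution_tendsto[OF f x x] vdot_self[OF x] by (intro LIMSEQ_le_const) auto
qed

lemma E_nonneg: "continuous_on UNIV f \<Longrightarrow> positive_type n f \<Longrightarrow> E f \<ge> 0"
  using coef_nonneg[of f 0] by (simp add: coef_0)

text \<open>If no P j t were negative, the constant term of the peak expansion would keep
  \<open>poly (peak m) t\<close> at least 1. Yet consecutive kernel values have ratio tending to t^2
  < 1, so they tend to 0.\<close>

lemma exists_ultra_neg:
  assumes t: "\<bar>t\<bar> < 1"
  shows "\<exists>j. poly (P j) t < 0"
proof (rule ccontr)
  assume "\<not> (\<exists>j. poly (P j) t < 0)"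
  then have nonneg: "poly (P j) t \<ge> 0" for j by (simp add: not_less)
  have ge1: "poly (peak m) t \<ge> 1" for m
  proof -
    obtain b where b: "\<forall>l. b l \<ge> 0" "b 0 = 1" "peak m = (\<Sum>l\<le>2 * m + 1. smult (b l) (P l))"
      using peak_expansion by blast
    have "b 0 * poly (P 0) t \<le> (\<Sum>l\<le>2 * m + 1. b l * poly (P l) t)"
      using b(1) nonneg by (intro member_le_sum) auto
    then show ?thesis unfolding b(3) by (simp add: b(2) poly_sum del: sum.atMost_Suc)
  qed
  have t2: "t\<^sup>2 < 1" using t by (simp add: abs_square_less_1)
  \<comment> \<open>The midpoint of t^2 and 1; the ratio t^2 (2 m + n) / (2 m + 1) falls below it
    from N on.\<close>
  define c where "c = (1 + t\<^sup>2) / 2"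
  have c: "t\<^sup>2 < c" "c < 1" "c > 0" using t2 by (auto simp: c_def add_pos_nonneg)
  obtain N :: nat where N: "real n < real N * (c - t\<^sup>2)"
    using reals_Archimedean3[of "c - t\<^sup>2"] c by auto
  have "summable (\<lambda>m. poly (peak m) t)"
  proof (rule summable_ratio_test[OF c(2)])
    fix m assume m: "N \<le> m"
    have "real N * (c - t\<^sup>2) \<le> real m * (c - t\<^sup>2)"
      using m c by (intro mult_right_mono) auto
    moreover have "t\<^sup>2 * real n \<le> 1 * real n"
      using t2 by (intro mult_right_mono) auto
    moreover have "0 \<le> real m * (c - t\<^sup>2)" using c by simp
    ultimately have le: "t\<^sup>2 * (2 * real m + real n) \<le> c * (2 * real m + 1)"
      using N c(3) by (simp add: algebra_simps)
    have "\<kappa> (2 * m + 2) = (2 * real m + 1) * \<kappa> (2 * m) / (2 * real m + real n)"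
      using \<kappa>_rec[of "2 * m"] n2 by (simp add: field_simps)
    then have "poly (peak (Suc m)) t
      = poly (peak m) t * (t\<^sup>2 * (2 * real m + real n) / (2 * real m + 1))"
      by (simp add: poly_peak power2_eq_square mult_ac)
    also have "\<dots> \<le> poly (peak m) t * c"
      using ge1[of m] le by (intro mult_left_mono) (auto simp: pos_divide_le_eq)
    finally show "norm (poly (peak (Suc m)) t) \<le> c * norm (poly (peak m) t)"
      using ge1[of m] ge1[of "Suc m"] by (simp add: mult.commute)
  qed
  then have "(\<lambda>m. poly (peak m) t) \<longlonglongrightarrow> 0"
    by (rule summable_LIMSEQ_zero)
  then have "1 \<le> (0 :: real)"
    by (rule LIMSEQ_le_const) (use ge1 in auto)
  then show False by simp
qed

end

section \<open>The recursion for theta\<close>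

lemma positive_type_add:
  assumes "positive_type n f" "positive_type n g"
  shows "positive_type n (\<lambda>u. f u + g u)"
  using assms unfolding positive_type_def psd_on_def
  by (simp add: distrib_right sum.distrib)

lemma positive_type_cmult:
  assumes "positive_type n f" "a \<ge> 0"
  shows "positive_type n (\<lambda>u. a * f u)"
  unfolding positive_type_def psd_on_def
proof (intro allI impI conjI ballI)
  fix U and c :: "(nat \<Rightarrow> real) \<Rightarrow> real"
  assume "finite U" "U \<subseteq> unit_sphere n"
  then have "0 \<le> a * (\<Sum>x\<in>U. \<Sum>y\<in>U. f (vdot n x y) * c x * c y)"
    using assms unfolding positive_type_def psd_on_def by (intro mult_nonneg_nonneg) auto
  then show "0 \<le> (\<Sum>x\<in>U. \<Sum>y\<in>U. a * f (vdot n x y) * c x * c y)"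
    by (simp add: sum_distrib_left mult.assoc)
qed (simp add: vdot_commute)

lemma positive_type_cong:
  assumes "\<And>u. u \<in> {-1..1} \<Longrightarrow> f u = g u"
  shows "positive_type n f \<longleftrightarrow> positive_type n g"
proof -
  have "psd_on U (\<lambda>x y. f (vdot n x y)) \<longleftrightarrow> psd_on U (\<lambda>x y. g (vdot n x y))" if "U \<subseteq> unit_sphere n" for U
  proof -
    have "f (vdot n x y) = g (vdot n x y)" if "x \<in> U" "y \<in> U" for x y
      using that \<open>U \<subseteq> unit_sphere n\<close> by (intro assms vdot_in_Icc) auto
    then show ?thesis unfolding psd_on_def by simp
  qed
  then show ?thesis unfolding positive_type_def by blast
qed

lemma sphere_integral_cong:
  assumes "\<And>u. u \<in> {-1..1} \<Longrightarrow> f u = g u"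
  shows "sphere_integral n f = sphere_integral n g"
  unfolding sphere_integral_def
  by (intro Bochner_Integration.integral_cong refl assms vdot_in_Icc) (simp_all add: space_sphere_measure)

definition sphere_admissible :: "nat \<Rightarrow> (real \<Rightarrow> real) \<Rightarrow> bool" where
  "sphere_admissible n f \<longleftrightarrow> continuous_on {-1..1} f \<and> positive_type n f \<and> f 1 = 1"

text \<open>The preceding analysis concerns functions continuous on the whole line; clamping the
  argument to [-1,1] provides them.\<close>

lemma continuous_extension:
  assumes "continuous_on {-1..1} (f :: real \<Rightarrow> real)"
  shows "\<exists>g. continuous_on UNIV g \<and> (\<forall>u\<in>{-1..1}. g u = f u)"
proof (intro exI conjI ballI)
  show "continuous_on UNIV (\<lambda>u. f (max (-1) (min 1 u)))"
    by (intro continuous_on_compose2[OF assms] continuous_intros) auto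
qed auto

section \<open>Extremal functions and the supremum\<close>

context sphere
begin

lemma admissible_bounds:
  assumes "sphere_admissible n f"
  shows "0 \<le> sphere_integral n f" "sphere_integral n f \<le> 1"
    and "t \<in> {-1..1} \<Longrightarrow> (\<And>l. l \<ge> 1 \<Longrightarrow> M \<le> poly (P l) t)
      \<Longrightarrow> sphere_integral n f + M * (1 - sphere_integral n f) \<le> f t"
proof -
  obtain g where g: "continuous_on UNIV g" "\<forall>u\<in>{-1..1}. g u = f u"
    using continuous_extension assms unfolding sphere_admissible_def by blast
  have pt: "positive_type n g"
    using positive_type_cong[of g f n] g(2) assms unfolding sphere_admissible_def by blast
  have I: "sphere_integral n f = E g"
    using sphere_integral_cong[of g f n] g(2) sphere_integral_eq_E[OF g(1)] by simp
  have "g 1 = 1" using g(2) assms by (simp add: sphere_admissible_def)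
  then show "0 \<le> sphere_integral n f" "sphere_integral n f \<le> 1"
    using E_nonneg[OF g(1) pt] E_le[OF g(1) pt] I by auto
  show "sphere_integral n f + M * (1 - sphere_integral n f) \<le> f t"
    if "t \<in> {-1..1}" "\<And>l. l \<ge> 1 \<Longrightarrow> M \<le> poly (P l) t"
    using positive_type_lower_bound[OF g(1) pt that] that(1) g(2) I \<open>g 1 = 1\<close> by simp
qed

definition mixture :: "real \<Rightarrow> nat \<Rightarrow> real \<Rightarrow> real" where
  "mixture a j u = a + (1 - a) * poly (P j) u"

lemma mixture:
  assumes "a \<in> {0..1}" "j \<ge> 1"
  shows "sphere_admissible n (mixture a j)" "sphere_integral n (mixture a j) = a"
proof -
  have cont: "continuous_on A (mixture a j)" for A
    unfolding mixture_def by (intro continuous_intros)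
  have eq: "mixture a j = (\<lambda>u. a * poly (P 0) u + (1 - a) * poly (P j) u)"
    by (simp add: mixture_def fun_eq_iff)
  have "positive_type n (mixture a j)"
    unfolding eq using assms
    by (intro positive_type_add positive_type_cmult positive_type_ultra) auto
  then show "sphere_admissible n (mixture a j)"
    using cont by (simp add: sphere_admissible_def mixture_def ultra_1)
  have "poly (smult a (P 0) + smult (1 - a) (P j)) = mixture a j"
    by (simp add: eq fun_eq_iff)
  then have "E (mixture a j) = a * E (poly (P 0)) + (1 - a) * E (poly (P j))"
    using L_add[of "smult a (P 0)" "smult (1 - a) (P j)"] unfolding L_smult by simp
  moreover have "E (poly (P j)) = 0" using L_ultra[of "j - 1"] assms(2) by simp
  ultimately show "sphere_integral n (mixture a j) = a"
    using L_1 by (simp add: sphere_integral_eq_E[OF cont])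
qed

text \<open>Shows that the set in the case k = 2 is nonempty, so that its supremum is meaningful. At
  t = -1 the polynomial P 1 is negative.\<close>

lemma exists_admissible_zero:
  assumes "t \<in> {-1..<1}"
  shows "\<exists>f. sphere_admissible n f \<and> f t = 0"
proof -
  have "\<exists>j. poly (P j) t < 0"
  proof (cases "t = -1")
    case True
    then show ?thesis by (intro exI[of _ 1]) simp
  next
    case False
    then show ?thesis using assms by (intro exists_ultra_neg) auto
  qed
  then obtain j where j: "poly (P j) t < 0" by blast
  then have "j \<ge> 1" by (cases j) auto
  \<comment> \<open>The root of a + (1 - a) P j t = 0; it lies in [0,1] because P j t < 0.\<close>
  define a where "a = - poly (P j) t / (1 - poly (P j) t)"
  have "a \<in> {0..1}" using j by (simp add: a_def divide_simps)
  moreover have "mixture a j t = 0" using j by (simp add: mixture_def a_def field_simps)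
  ultimately show ?thesis using mixture(1) \<open>j \<ge> 1\<close> by blast
qed

text \<open>The values P j t tend to 0 since d = n - 2 is positive, so all but finitely many exceed
  a fixed negative one; a finite minimum is then the global one.\<close>

lemma jacobi_min_attained:
  assumes n3: "n \<ge> 3" and t: "\<bar>t\<bar> < 1"
  shows "\<exists>j\<ge>1. jacobi_min n t = poly (P j) t \<and> poly (P j) t < 0 \<and> (\<forall>l. poly (P j) t \<le> poly (P l) t)"
proof -
  obtain i where i: "poly (P i) t < 0" using exists_ultra_neg[OF t] by blast
  have "(\<lambda>j. poly (P j) t) \<longlonglongrightarrow> 0"
    using n3 poly_ultra_Suc_Suc[of "real n - 2" _ t]
    by (intro damped_recurrence_tendsto_0[of "real n - 2" t] t) auto
  then have "\<forall>\<^sub>F j in sequentially. poly (P i) t < poly (P j) t"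
    by (rule order_tendstoD) (rule i)
  then obtain N where N: "\<And>j. j \<ge> N \<Longrightarrow> poly (P i) t < poly (P j) t"
    by (auto simp: eventually_sequentially)
  \<comment> \<open>The range includes i, so the finite minimum is at most P i t and thus lies below
    the whole tail.\<close>
  have "\<exists>j\<in>{..max i N}. \<forall>l\<in>{..max i N}. poly (P j) t \<le> poly (P l) t"
    using ex_is_arg_min_if_finite[of "{..max i N}" "\<lambda>j. poly (P j) t"]
    by (auto simp: is_arg_min_linorder)
  then obtain j where j: "\<And>l. l \<le> max i N \<Longrightarrow> poly (P j) t \<le> poly (P l) t" by auto
  have min: "poly (P j) t \<le> poly (P l) t" for l
  proof (cases "l \<le> max i N")
    case False
    then have "poly (P i) t < poly (P l) t" by (intro N) simp
    then show ?thesis using j[of i] by simp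
  qed (rule j)
  have neg: "poly (P j) t < 0" using j[of i] i by simp
  have "jacobi_min n t = poly (P j) t"
    unfolding jacobi_min_def jacobi_sphere_eq_ultra[OF n2]
    by (rule Least_equality) (auto intro: min)
  moreover have "j \<ge> 1" using neg by (cases j) auto
  ultimately show ?thesis using neg min by blast
qed

text \<open>The weight a = (c - M) / (1 - M) solves a + (1 - a) M = c, and M < 0 with c in [0,1]
  places it in [0,1]. So the mixture is admissible and attains the upper bound.\<close>

lemma Sup_admissible_le:
  assumes n3: "n \<ge> 3" and t: "\<bar>t\<bar> < 1" and c: "c \<in> {0..1}"
  defines "M \<equiv> jacobi_min n t"
  shows "Sup {sphere_integral n f | f. sphere_admissible n f \<and> f t \<le> c} = (c - M) / (1 - M)"
    and "(c - M) / (1 - M) \<in> {0..1}"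
proof -
  obtain j where j: "j \<ge> 1" "M = poly (P j) t" "M < 0" "\<And>l. M \<le> poly (P l) t"
    using jacobi_min_attained[OF n3 t] unfolding M_def by metis
  have tI: "t \<in> {-1..1}" using t by auto
  define a where "a = (c - M) / (1 - M)"
  have a: "a \<in> {0..1}" using j(3) c by (simp add: a_def divide_simps)
  then show "(c - M) / (1 - M) \<in> {0..1}" by (simp add: a_def)
  have "a * (1 - M) = c - M" using j(3) by (simp add: a_def)
  then have "mixture a j t = c"
    by (simp add: mixture_def j(2)[symmetric] algebra_simps)
  then have "a \<in> {sphere_integral n f | f. sphere_admissible n f \<and> f t \<le> c}"
    using mixture[OF a j(1)] by force
  moreover have "x \<le> a" if x: "x \<in> {sphere_integral n f | f. sphere_admissible n f \<and> f t \<le> c}" for x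
  proof -
    obtain f where f: "x = sphere_integral n f" "sphere_admissible n f" "f t \<le> c" using x by blast
    have "x + M * (1 - x) \<le> c"
      using order_trans[OF admissible_bounds(3)[OF f(2) tI j(4)] f(3)] by (simp add: f(1))
    then show ?thesis using j(3) by (simp add: a_def field_simps)
  qed
  ultimately show "Sup {sphere_integral n f | f. sphere_admissible n f \<and> f t \<le> c} = (c - M) / (1 - M)"
    unfolding a_def[symmetric] by (rule cSup_eq_maximum)
qed

end

text \<open>Base of the invariant: every admissible function has integral in [0,1], and one with f t
  = 0 exists.\<close>

lemma theta_2_bounds:
  assumes "n \<ge> 2" "t \<in> {-1..<1}"
  shows "theta n 2 t \<in> {0..1}"
proof -
  interpret sphere n by unfold_locales (rule assms(1))
  let ?A = "{sphere_integral n f | f. sphere_admissible n f \<and> f t = 0}"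
  have theta: "theta n 2 t = Sup ?A"
    by (simp add: theta.simps[of n 2] sphere_admissible_def conj_assoc)
  obtain f where f: "sphere_admissible n f" "f t = 0"
    using exists_admissible_zero[OF assms(2)] by blast
  then have mem: "sphere_integral n f \<in> ?A" by blast
  have le: "x \<le> 1" if "x \<in> ?A" for x using that admissible_bounds(2) by auto
  then have "bdd_above ?A" by (intro bdd_aboveI)
  then have "sphere_integral n f \<le> Sup ?A" using mem by (intro cSup_upper)
  moreover have "0 \<le> sphere_integral n f" using admissible_bounds(1)[OF f(1)] .
  moreover have "Sup ?A \<le> 1" using mem le by (intro cSup_least) auto
  ultimately show ?thesis using theta by simp
qed

text \<open>The map t / (1 + t) is increasing for t > -1 and sends -1 / q to -1 / (q - 1), the left
  endpoint for k - 1 when q = k - 1.\<close>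

lemma theta_recursion_argument:
  assumes "k \<ge> 3" "t \<in> {-1 / (real k - 1)..<1}"
  shows "\<bar>t\<bar> < 1" "t / (1 + t) \<in> {-1 / (real (k - 1) - 1)..<1}"
proof -
  define q where "q = real k - 1"
  have q: "q \<ge> 2" using assms(1) by (simp add: q_def)
  have "-1 / q \<le> t" using assms(2) by (simp add: q_def)
  then have qt: "-1 \<le> q * t" using q by (simp add: field_simps)
  have "-1 < -1 / q" using q by (simp add: field_simps)
  then have t: "-1 < t" "t < 1" using \<open>-1 / q \<le> t\<close> assms(2) by auto
  then show "\<bar>t\<bar> < 1" by simp
  have "-1 / (q - 1) \<le> t / (1 + t)"
    using qt q t by (simp add: field_simps)
  moreover have "t / (1 + t) < 1" using t by (simp add: field_simps)
  moreover have "real (k - 1) - 1 = q - 1" using assms(1) by (simp add: q_def)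
  ultimately show "t / (1 + t) \<in> {-1 / (real (k - 1) - 1)..<1}" by simp
qed

lemma theta_step:
  assumes "n \<ge> k" "k \<ge> 3" "t \<in> {-1 / (real k - 1)..<1}"
    and "theta (n - 1) (k - 1) (t / (1 + t)) \<in> {0..1}"
  shows "theta n k t = (theta (n - 1) (k - 1) (t / (1 + t)) - jacobi_min n t) / (1 - jacobi_min n t)"
    and "theta n k t \<in> {0..1}"
proof -
  interpret sphere n by unfold_locales (use assms in simp)
  let ?c = "theta (n - 1) (k - 1) (t / (1 + t))"
  have "theta n k t = Sup {sphere_integral n f | f. sphere_admissible n f \<and> f t \<le> ?c}"
    using assms(2) by (simp add: theta.simps[of n k] sphere_admissible_def conj_assoc)
  moreover have "n \<ge> 3" using assms by simp
  note Sup_admissible_le[OF this theta_recursion_argument(1)[OF assms(2,3)] assms(4)]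
  ultimately show "theta n k t = (?c - jacobi_min n t) / (1 - jacobi_min n t)"
    and "theta n k t \<in> {0..1}"
    by simp_all
qed

text \<open>Supplies the hypothesis of \<open>theta_step\<close> at each level; the dimension
  decreases together with k, so \<open>n \<ge> k\<close> persists.\<close>

lemma theta_bounds:
  "k \<ge> 2 \<Longrightarrow> n \<ge> k \<Longrightarrow> t \<in> {-1 / (real k - 1)..<1} \<Longrightarrow> theta n k t \<in> {0..1}"
proof (induction k arbitrary: n t rule: dec_induct)
  case base
  then show ?case by (intro theta_2_bounds) auto
next
  case (step k)
  have t: "t / (1 + t) \<in> {-1 / (real k - 1)..<1}"
    using theta_recursion_argument(2)[of "Suc k" t] step.hyps(1) step.prems(2) by simp
  have "theta (n - 1) k (t / (1 + t)) \<in> {0..1}"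
    by (rule step.IH[OF _ t]) (use step.prems(1) in simp)
  then have c: "theta (n - 1) (Suc k - 1) (t / (1 + t)) \<in> {0..1}"
    by (simp only: diff_Suc_1)
  have "Suc k \<ge> 3" using step.hyps(1) by simp
  then show ?case
    by (rule theta_step(2)[OF step.prems(1) _ step.prems(2) c])
qed

theorem theorem2p2:
  fixes n k :: nat and t :: real
  assumes "n \<ge> k" and "k \<ge> 3"
    and "t \<in> {-1 / (real k - 1)..<1}"
  shows "theta n k t =
    (theta (n - 1) (k - 1) (t / (1 + t)) - jacobi_min n t) / (1 - jacobi_min n t)"
proof (rule theta_step(1)[OF assms])
  show "theta (n - 1) (k - 1) (t / (1 + t)) \<in> {0..1}"
    by (rule theta_bounds[OF _ _ theta_recursion_argument(2)[OF assms(2,3)]]) (use assms in auto)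
qed

end
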